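(* Let $k\ge2$ and let $\Sigma$ be a Borel probability measure on the set of $k\times k$ column-stochastic matrices that is absolutely continuous with respect to Lebesgue measure on that set, with density of class $L^p$ for some $p>1$. Let $S_1,S_2,\dots$ be i.i.d. with law $\Sigma$, $Q_m=S_mS_{m-1}\cdots S_1$, and let $\lambda_1\in(0,1)$ be the constant such that $\lim_{m\to\infty}\lambda_{m,1}^{1/m}=\lambda_1$ almost surely, where $\lambda_{m,1}$ is the largest singular value of the restriction $Q_m|V$. Put $$\theta=-\frac{1}{2\log\lambda_1}.$$ Then the EFCP chains on $[k]^{[n]}$ with paintbox measure $\Sigma$ exhibit the cutoff phenomenon: for all $\varepsilon,\delta\in(0,1/2)$, if $n$ is sufficiently large, then $$(\theta-\delta)\log n\le t^{(n)}_{\mathrm{mix}}(1-\varepsilon)\le t^{(n)}_{\mathrm{mix}}(\varepsilon)\le(\theta+\delta)\log n.$$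
   Context: Notation: $[k]=\{1,\dots,k\}$; $\Delta_k=\{s\in\mathbb R^k:s_i\ge0,\ \sum_i s_i=1\}$; a $k\times k$ matrix $S$ is column-stochastic if its columns lie in $\Delta_k$; $S(a,b)$ is the entry in row $a$, column $b$. The set of such matrices is identified with $\Delta_k^k$. $V=\{v\in\mathbb R^k:\sum_i v_i=0\}$ with the Euclidean inner product; it is invariant under column-stochastic matrices. Lebesgue measure on $\Delta_k$ is the translate of Lebesgue measure on $V$ (unique up to scalar), and Lebesgue measure on $\Delta_k^k$ is its $k$-fold product. Under the stated hypothesis on $\Sigma$, the almost sure limit $\lambda_1=\lim_m\lambda_{m,1}^{1/m}$ exists, is non-random, and satisfies $0<\lambda_1<1$. The EFCP (exchangeable Feller cut-and-paste) chain on $[k]^{[n]}$ with paintbox measure $\Sigma$ is the time-homogeneous Markov chain with transition probabilities $P(x,y)=\int \prod_{i=1}^n S(y^i,x^i)\,\Sigma(dS)$ for $x=x^1\cdots x^n$, $y=y^1\cdots y^n\in[k]^{[n]}$. Under the hypothesis it has a unique stationary distribution $\pi^{(n)}$. With $\mathcal D(X_m)$ the law of the chain at time $m$, $t^{(n)}_{\mathrm{mix}}(\varepsilon)=\min\{m\ge 1:\max_{x_0}\|\mathcal D(X_m)-\pi^{(n)}\|_{TV}<\varepsilon\}$, where the maximum is over initial states $X_0=x_0$ and $\|\mu-\nu\|_{TV}=\frac12\sum_x|\mu(x)-\nu(x)|$. *)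

theory Defs
  imports "HOL-Analysis.Analysis" "HOL-Probability.Probability"
begin

section \<open>The simplex, column-stochastic matrices and Lebesgue measure on them\<close>

definition zero_sum_space :: "(real ^ 'k) set" where
  "zero_sum_space = {v. (\<Sum>i\<in>UNIV. v $ i) = 0}"

definition prob_simplex :: "(real ^ 'k) set" where
  "prob_simplex = {s. (\<forall>i. 0 \<le> s $ i) \<and> (\<Sum>i\<in>UNIV. s $ i) = 1}"

text \<open>The entry \<open>S(a, b)\<close> in row \<open>a\<close> and column \<open>b\<close> is \<open>S $ a $ b\<close>.\<close>

definition column_stochastic :: "(real ^ 'k ^ 'k) set" where
  "column_stochastic = {S. \<forall>b. column b S \<in> prob_simplex}"

definition orthonormal_basis_of :: "'a::euclidean_space set \<Rightarrow> 'a set \<Rightarrow> bool" where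
  "orthonormal_basis_of V B \<longleftrightarrow>
     B \<subseteq> V \<and> pairwise orthogonal B \<and> (\<forall>b\<in>B. norm b = 1) \<and> span B = V"

text \<open>
  Lebesgue measure on a linear subspace, normalised by the inner product: the image of the product
  Lebesgue measure under coordinates in an orthonormal basis. The result does not depend on the
  basis chosen (and a different normalisation would only change it by a positive scalar).
\<close>

definition lebesgue_subspace :: "'a::euclidean_space set \<Rightarrow> 'a measure" where
  "lebesgue_subspace V =
     (let B = (SOME B. orthonormal_basis_of V B)
      in distr (PiM B (\<lambda>_. lborel)) borel (\<lambda>c. \<Sum>b\<in>B. c b *\<^sub>R b))"

text \<open>
  The simplex lies in the translate of the space of zero-sum vectors by its barycentre; any other
  point of the simplex could be used for the translation.
\<close>

definition lebesgue_simplex :: "(real ^ 'k) measure" where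
  "lebesgue_simplex =
     restrict_space
       (distr (lebesgue_subspace zero_sum_space) borel (\<lambda>v. (\<chi> i. 1 / real CARD('k)) + v))
       prob_simplex"

definition lebesgue_column_stochastic :: "(real ^ 'k ^ 'k) measure" where
  "lebesgue_column_stochastic =
     distr (PiM (UNIV :: 'k set) (\<lambda>_. lebesgue_simplex))
       (restrict_space borel column_stochastic) (\<lambda>c. \<chi> a b. c b $ a)"

section \<open>Singular values of a restriction to a subspace\<close>

text \<open>
  \<open>g\<close> is the adjoint of the restriction of \<open>f\<close> to the \<open>f\<close>-invariant subspace \<open>V\<close>. On \<open>V\<close> it
  is uniquely determined; in general it differs from the adjoint of \<open>f\<close> on the whole space,
  which need not preserve \<open>V\<close>.
\<close>

definition adjoint_on :: "'a::real_inner set \<Rightarrow> ('a \<Rightarrow> 'a) \<Rightarrow> ('a \<Rightarrow> 'a) \<Rightarrow> bool" where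
  "adjoint_on V f g \<longleftrightarrow> g ` V \<subseteq> V \<and> (\<forall>v\<in>V. \<forall>w\<in>V. f v \<bullet> w = v \<bullet> g w)"

text \<open>Singular values are the square roots of the eigenvalues of \<open>(f|V)\<^sup>* (f|V)\<close>.\<close>

definition singular_values_on :: "'a::real_inner set \<Rightarrow> ('a \<Rightarrow> 'a) \<Rightarrow> real set" where
  "singular_values_on V f =
     {s. 0 \<le> s \<and> (\<exists>g. adjoint_on V f g \<and> (\<exists>v\<in>V. v \<noteq> 0 \<and> g (f v) = s\<^sup>2 *\<^sub>R v))}"

definition largest_singular_value_on :: "'a::real_inner set \<Rightarrow> ('a \<Rightarrow> 'a) \<Rightarrow> real" where
  "largest_singular_value_on V f = Max (singular_values_on V f)"

primrec left_product :: "(nat \<Rightarrow> real ^ 'k ^ 'k) \<Rightarrow> nat \<Rightarrow> real ^ 'k ^ 'k" where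
  "left_product S 0 = mat 1"
| "left_product S (Suc m) = S (Suc m) ** left_product S m"

section \<open>EFCP chains\<close>

text \<open>
  The set \<open>[k]\<^bsup>[n]\<^esup>\<close> of words of length \<open>n\<close>. Distributions on it are represented by their
  probability mass functions.
\<close>

definition words :: "nat \<Rightarrow> (nat \<Rightarrow> 'k) set" where
  "words n = {1..n} \<rightarrow>\<^sub>E UNIV"

definition efcp_kernel ::
  "(real ^ 'k ^ 'k) measure \<Rightarrow> nat \<Rightarrow> (nat \<Rightarrow> 'k) \<Rightarrow> (nat \<Rightarrow> 'k) \<Rightarrow> real" where
  "efcp_kernel Sig n x y = (\<integral>S. (\<Prod>i=1..n. S $ y i $ x i) \<partial>Sig)"

primrec efcp_law ::
  "(real ^ 'k ^ 'k) measure \<Rightarrow> nat \<Rightarrow> (nat \<Rightarrow> 'k) \<Rightarrow> nat \<Rightarrow> (nat \<Rightarrow> 'k) \<Rightarrow> real" where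
  "efcp_law Sig n x0 0 = (\<lambda>y. if y = x0 then 1 else 0)"
| "efcp_law Sig n x0 (Suc m) =
     (\<lambda>y. \<Sum>x\<in>words n. efcp_law Sig n x0 m x * efcp_kernel Sig n x y)"

text \<open>
  Mass functions are required to vanish off \<open>words n\<close> so that a stationary distribution is
  unique as a function on the ambient type.
\<close>

definition efcp_stationary_distribution ::
  "(real ^ 'k ^ 'k) measure \<Rightarrow> nat \<Rightarrow> ((nat \<Rightarrow> 'k) \<Rightarrow> real) \<Rightarrow> bool" where
  "efcp_stationary_distribution Sig n q \<longleftrightarrow>
     (\<forall>x. 0 \<le> q x) \<and> (\<forall>x. x \<notin> words n \<longrightarrow> q x = 0) \<and> (\<Sum>x\<in>words n. q x) = 1 \<and>
     (\<forall>y\<in>words n. (\<Sum>x\<in>words n. q x * efcp_kernel Sig n x y) = q y)"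

definition efcp_stationary ::
  "(real ^ 'k ^ 'k) measure \<Rightarrow> nat \<Rightarrow> (nat \<Rightarrow> 'k) \<Rightarrow> real" where
  "efcp_stationary Sig n = (THE q. efcp_stationary_distribution Sig n q)"

definition tv_dist :: "'a set \<Rightarrow> ('a \<Rightarrow> real) \<Rightarrow> ('a \<Rightarrow> real) \<Rightarrow> real" where
  "tv_dist X p q = (1 / 2) * (\<Sum>x\<in>X. \<bar>p x - q x\<bar>)"

definition efcp_mixing_time :: "(real ^ 'k ^ 'k) measure \<Rightarrow> nat \<Rightarrow> real \<Rightarrow> nat" where
  "efcp_mixing_time Sig n e =
     (LEAST m. 1 \<le> m \<and>
        Max ((\<lambda>x0. tv_dist (words n) (efcp_law Sig n x0 m) (efcp_stationary Sig n)) ` words n) < e)"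

end

theory Submission
  imports Defs
begin

text \<open>
  Given the matrices, the letters of the word at time \<open>m\<close> are independent, the letter at a position
  that started with \<open>a\<close> being drawn from column \<open>a\<close> of \<open>Q m\<close>; the largest singular value of \<open>Q m\<close>
  on zero-sum vectors is comparable to the largest difference of two entries in a row, so columns of
  \<open>Q m\<close> differ by about \<open>lam1 ^ m\<close>. Such a difference is visible in \<open>n\<close> independent samples exactly
  when it is large compared to \<open>1 / sqrt n\<close>, that is for \<open>m < \<theta> * ln n\<close>. For the upper bound, the
  chi-squared distance of the two product laws is small, because the entries of \<open>Q m\<close> are at least
  the smallest entry of \<open>S m\<close>, which is tight away from \<open>0\<close> by absolute continuity. For the lower
  bound, one starts from a word in which every letter is equally frequent and compares the letter
  frequencies in the blocks of positions with equal initial letter: in equilibrium they agree up to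
  \<open>1 / sqrt n\<close>.
\<close>

section \<open>The largest singular value as an operator norm\<close>

text \<open>The factor 1/2 in \<theta> is the exponent of \<open>1 / sqrt n\<close>: at time
  \<open>c * ln n\<close> a rate slightly above or below \<open>lam1\<close> turns the column
  differences into a power of \<open>n\<close> whose exponent lies strictly on one side of
  \<open>-1/2\<close>, and the remaining room absorbs every constant. Only an almost sure root limit
  is given, so each estimate holds off an event of small probability. Small entries are charged to
  the last factor \<open>S m\<close> alone: its law is the same at every time, so one threshold
  serves all \<open>m\<close>. The equilibrium has no formula. In the upper bound it is replaced by
  pairs of initial words, being itself a mixture of laws of the chain; in the lower bound its second
  moments are limits of those of a chain started at a constant word. Its existence and uniqueness,
  on which \<open>THE\<close> depends, come from the same contraction estimate. Which columns are
  far apart depends on the matrices, whereas a test event must be fixed; hence the union over all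
  triples of letters.\<close>

text \<open>Take the adjoint on the whole space and project orthogonally onto \<open>V\<close>; the
  projection leaves inner products with vectors of \<open>V\<close> unchanged.\<close>

lemma adjoint_on_exists:
  fixes f :: "'a::euclidean_space \<Rightarrow> 'a"
  assumes V: "subspace V" and f: "linear f"
  obtains g where "adjoint_on V f g"
proof -
  have "\<exists>y\<in>V. \<forall>v\<in>V. v \<bullet> adjoint f w = v \<bullet> y" for w
  proof -
    obtain y z where "y \<in> span V" "\<And>v. v \<in> span V \<Longrightarrow> orthogonal z v" "adjoint f w = y + z"
      using orthogonal_subspace_decomp_exists[of V "adjoint f w"] by metis
    then show ?thesis
      using V by (metis add.right_neutral inner_commute inner_right_distrib orthogonal_def span_eq_iff)
  qed
  then obtain g where g: "\<And>w. g w \<in> V" "\<And>v w. v \<in> V \<Longrightarrow> v \<bullet> adjoint f w = v \<bullet> g w"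
    by metis
  then have "adjoint_on V f g"
    unfolding adjoint_on_def using adjoint_works[OF f] by (auto simp: inner_commute)
  then show thesis by (rule that)
qed

text \<open>Trades the adjoint for an identity of inner products, so that later arguments do not
  depend on how \<open>g\<close> behaves off \<open>V\<close>.\<close>

lemma singular_values_onD:
  fixes f :: "'a::euclidean_space \<Rightarrow> 'a"
  assumes "f ` V \<subseteq> V" "s \<in> singular_values_on V f"
  obtains v where "0 \<le> s" "v \<in> V" "v \<noteq> 0" "\<And>w. w \<in> V \<Longrightarrow> f w \<bullet> f v = s\<^sup>2 * (w \<bullet> v)"
proof -
  obtain g v where g: "0 \<le> s" "adjoint_on V f g" "v \<in> V" "v \<noteq> 0" "g (f v) = s\<^sup>2 *\<^sub>R v"
    using assms(2) unfolding singular_values_on_def by auto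
  have "f w \<bullet> f v = s\<^sup>2 * (w \<bullet> v)" if "w \<in> V" for w
    using g assms(1) that unfolding adjoint_on_def by (auto simp: image_subset_iff)
  with g that show thesis by blast
qed

text \<open>Eigenvectors for distinct singular values are orthogonal, hence independent, and the
  dimension is finite. Without finiteness \<open>Max\<close> would carry no information.\<close>

lemma finite_singular_values_on:
  fixes f :: "'a::euclidean_space \<Rightarrow> 'a"
  assumes inv: "f ` V \<subseteq> V"
  shows "finite (singular_values_on V f)"
proof -
  let ?E = "singular_values_on V f"
  have "\<forall>s\<in>?E. \<exists>v. 0 \<le> s \<and> v \<in> V \<and> v \<noteq> 0 \<and> (\<forall>w\<in>V. f w \<bullet> f v = s\<^sup>2 * (w \<bullet> v))"
    using singular_values_onD[OF inv] by metis
  then obtain e where e: "\<And>s. s \<in> ?E \<Longrightarrow> 0 \<le> s" "\<And>s. s \<in> ?E \<Longrightarrow> e s \<in> V" "\<And>s. s \<in> ?E \<Longrightarrow> e s \<noteq> 0"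
    "\<And>s w. s \<in> ?E \<Longrightarrow> w \<in> V \<Longrightarrow> f w \<bullet> f (e s) = s\<^sup>2 * (w \<bullet> e s)"
    by metis
  have orth: "e s \<bullet> e t = 0" if "s \<in> ?E" "t \<in> ?E" "s \<noteq> t" for s t
  proof -
    have "s\<^sup>2 * (e s \<bullet> e t) = t\<^sup>2 * (e s \<bullet> e t)"
      using e(4)[of s "e t"] e(4)[of t "e s"] e(2) that by (metis inner_commute)
    moreover have "s\<^sup>2 \<noteq> t\<^sup>2" using e(1) that by (simp add: power2_eq_iff_nonneg)
    ultimately show ?thesis by simp
  qed
  have inj: "inj_on e ?E"
    by (intro inj_onI) (metis e(3) inner_eq_zero_iff orth)
  have "pairwise orthogonal (e ` ?E)"
    by (auto simp: pairwise_def orthogonal_def intro!: orth)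
  moreover have "0 \<notin> e ` ?E" using e(3) by auto
  ultimately have "independent (e ` ?E)" by (rule pairwise_orthogonal_independent)
  then show ?thesis using inj independent_imp_finite finite_image_iff by blast
qed

text \<open>Rayleigh's principle: a vector that maximises \<open>norm (f v)\<close> on the compact
  unit sphere of \<open>V\<close> is an eigenvector of the adjoint composed with \<open>f\<close>,
  and the maximum is the singular value.\<close>

lemma operator_norm_in_singular_values_on:
  fixes f :: "'a::euclidean_space \<Rightarrow> 'a"
  assumes V: "subspace V" "V \<noteq> {0}" and f: "linear f" and inv: "f ` V \<subseteq> V"
  obtains s where "s \<in> singular_values_on V f" "\<And>w. w \<in> V \<Longrightarrow> norm (f w) \<le> s * norm w"
proof -
  let ?K = "V \<inter> sphere 0 1"
  obtain w0 where w0: "w0 \<in> V" "w0 \<noteq> 0"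
    using V subspace_0 by auto
  then have "w0 /\<^sub>R norm w0 \<in> ?K"
    using V by (simp add: subspace_scale)
  then have "?K \<noteq> {}" by blast
  moreover have "compact ?K"
    using V by (intro closed_Int_compact closed_subspace) auto
  moreover have "continuous_on ?K (\<lambda>v. norm (f v))"
    using f by (intro continuous_intros linear_continuous_on) (simp add: linear_conv_bounded_linear)
  ultimately obtain v where v: "v \<in> ?K" "\<And>w. w \<in> ?K \<Longrightarrow> norm (f w) \<le> norm (f v)"
    using continuous_attains_sup[of ?K "\<lambda>v. norm (f v)"] by metis
  define s where "s = norm (f v)"
  have le: "norm (f w) \<le> s * norm w" if "w \<in> V" for w
  proof (cases "w = 0")
    case True
    then show ?thesis using linear_0[OF f] by simp
  next
    case False
    then have "w /\<^sub>R norm w \<in> ?K" using that V by (simp add: subspace_scale)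
    then have "norm (f (w /\<^sub>R norm w)) \<le> s" using v s_def by blast
    then show ?thesis
      using False by (simp add: linear_cmul[OF f] divide_simps mult.commute)
  qed
  obtain g where g: "adjoint_on V f g" using adjoint_on_exists[OF V(1) f] .
  \<comment> \<open>The quadratic form \<open>s\<^sup>2 * (w \<bullet> w) - f w \<bullet> f w\<close> is nonnegative on \<open>V\<close> and vanishes at \<open>v\<close>, so
    \<open>v\<close> lies in its radical.\<close>
  have crit: "s\<^sup>2 * (w \<bullet> v) = f w \<bullet> f v" if w: "w \<in> V" for w
  proof (rule ccontr)
    define b where "b = s\<^sup>2 * (w \<bullet> v) - f w \<bullet> f v"
    define a where "a = s\<^sup>2 * (w \<bullet> w) - f w \<bullet> f w"
    assume "\<not> ?thesis"
    then have "b \<noteq> 0" by (simp add: b_def)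
    have quad: "0 \<le> 2 * t * b + t\<^sup>2 * a" for t
    proof -
      have "v + t *\<^sub>R w \<in> V" using v w V by (simp add: subspace_add subspace_scale)
      then have "(norm (f (v + t *\<^sub>R w)))\<^sup>2 \<le> (s * norm (v + t *\<^sub>R w))\<^sup>2"
        by (intro power_mono le) auto
      moreover have expand: "(norm (x + t *\<^sub>R y))\<^sup>2 = (norm x)\<^sup>2 + 2 * t * (y \<bullet> x) + t\<^sup>2 * (y \<bullet> y)"
        for x y :: 'a
        unfolding power2_norm_eq_inner
        by (simp add: inner_add_left inner_add_right inner_commute power2_eq_square algebra_simps)
      moreover have "(norm (f v))\<^sup>2 = s\<^sup>2" "(norm v)\<^sup>2 = 1" using v by (auto simp: s_def)
      moreover have "f (v + t *\<^sub>R w) = f v + t *\<^sub>R f w"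
        by (simp add: linear_add[OF f] linear_cmul[OF f])
      ultimately show ?thesis
        unfolding a_def b_def power_mult_distrib expand by (simp add: expand algebra_simps)
    qed
    \<comment> \<open>The minimiser of \<open>2 * t * b + t\<^sup>2 * (\<bar>a\<bar> + 1)\<close>.
      Replacing \<open>a\<close> by the positive majorant avoids a case distinction on its
      sign.\<close>
    define t where "t = - b / (\<bar>a\<bar> + 1)"
    have "2 * t * b + t\<^sup>2 * a \<le> 2 * t * b + t\<^sup>2 * (\<bar>a\<bar> + 1)"
      by (intro add_left_mono mult_left_mono) auto
    also have "\<dots> = - b\<^sup>2 / (\<bar>a\<bar> + 1)"
    proof -
      have "2 * (- b / A) * b + (- b / A)\<^sup>2 * A = - b\<^sup>2 / A" if "A \<noteq> 0" for A
        using that by (simp add: field_simps power2_eq_square)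
      then show ?thesis unfolding t_def by (smt (verit))
    qed
    also have "\<dots> < 0" using \<open>b \<noteq> 0\<close> by (simp add: divide_neg_pos)
    finally show False using quad[of t] by simp
  qed
  have gv: "g (f v) \<in> V" using g v inv unfolding adjoint_on_def by blast
  have "w \<bullet> (g (f v) - s\<^sup>2 *\<^sub>R v) = 0" if "w \<in> V" for w
    using g crit[OF that] v that inv unfolding adjoint_on_def
    by (auto simp: inner_diff_right image_subset_iff)
  moreover have "g (f v) - s\<^sup>2 *\<^sub>R v \<in> V"
    using gv v V by (simp add: subspace_diff subspace_scale)
  ultimately have "g (f v) = s\<^sup>2 *\<^sub>R v" by (metis eq_iff_diff_eq_0 inner_eq_zero_iff)
  moreover have "v \<noteq> 0" using v by auto
  ultimately have "s \<in> singular_values_on V f"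
    using g v unfolding singular_values_on_def by (auto simp: s_def)
  then show thesis using le that by blast
qed

text \<open>\<open>Max\<close> is the operator norm on \<open>V\<close>, with equality attained.
  That \<open>V\<close> is nontrivial makes the set of singular values nonempty, so that
  \<open>Max\<close> belongs to it.\<close>

lemma largest_singular_value_on:
  fixes f :: "'a::euclidean_space \<Rightarrow> 'a"
  assumes "subspace V" "V \<noteq> {0}" "linear f" "f ` V \<subseteq> V"
  shows largest_singular_value_on_nonneg: "0 \<le> largest_singular_value_on V f"
    and norm_le_largest_singular_value_on:
      "w \<in> V \<Longrightarrow> norm (f w) \<le> largest_singular_value_on V f * norm w"
    and largest_singular_value_on_attained:
      "\<exists>v\<in>V. v \<noteq> 0 \<and> norm (f v) = largest_singular_value_on V f * norm v"
proof -
  let ?m = "largest_singular_value_on V f"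
  obtain s where s: "s \<in> singular_values_on V f" "\<And>w. w \<in> V \<Longrightarrow> norm (f w) \<le> s * norm w"
    using operator_norm_in_singular_values_on[OF assms] by metis
  note fin = finite_singular_values_on[OF assms(4)]
  have "s \<le> ?m" unfolding largest_singular_value_on_def using fin s by simp
  then show "w \<in> V \<Longrightarrow> norm (f w) \<le> ?m * norm w"
    using s(2) by (meson mult_right_mono norm_ge_zero order_trans)
  have "?m \<in> singular_values_on V f"
    unfolding largest_singular_value_on_def using fin s by (intro Max_in) auto
  then obtain v where v: "0 \<le> ?m" "v \<in> V" "v \<noteq> 0" "\<And>w. w \<in> V \<Longrightarrow> f w \<bullet> f v = ?m\<^sup>2 * (w \<bullet> v)"
    using singular_values_onD[OF assms(4)] by metis
  show "0 \<le> ?m" by fact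
  have "(norm (f v))\<^sup>2 = (?m * norm v)\<^sup>2"
    using v(4)[OF v(2)] by (simp add: power2_norm_eq_inner power_mult_distrib)
  then have "norm (f v) = ?m * norm v" using v(1) by (simp add: power2_eq_iff_nonneg)
  then show "\<exists>v\<in>V. v \<noteq> 0 \<and> norm (f v) = ?m * norm v" using v by blast
qed

section \<open>Column-stochastic matrices acting on zero-sum vectors\<close>

lemma subspace_zero_sum_space: "subspace zero_sum_space"
  unfolding subspace_def zero_sum_space_def
  by (auto simp: sum.distrib simp flip: sum_distrib_left)

lemma axis_diff_in_zero_sum_space: "axis a 1 - axis b 1 \<in> zero_sum_space"
  unfolding zero_sum_space_def by (simp add: sum_subtractf axis_def)

lemma zero_sum_space_nontrivial:
  assumes "CARD('k) \<ge> 2"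
  shows "(zero_sum_space :: (real ^ 'k) set) \<noteq> {0}"
proof -
  obtain a b :: 'k where "a \<noteq> b"
    using assms card_2_iff' by (metis (full_types) One_nat_def Suc_1 UNIV_I card_le_Suc0_iff_eq finite not_less_eq_eq)
  then have "axis a 1 - axis b 1 \<noteq> (0 :: real ^ 'k)"
    by (simp add: axis_eq_axis)
  then show ?thesis using axis_diff_in_zero_sum_space[of a b] by (metis singletonD)
qed

lemma column_stochasticD:
  assumes "A \<in> column_stochastic"
  shows "0 \<le> A $ a $ b" "(\<Sum>a\<in>UNIV. A $ a $ b) = 1" "A $ a $ b \<le> 1"
proof -
  have *: "\<And>a b. 0 \<le> A $ a $ b" "\<And>b. (\<Sum>a\<in>UNIV. A $ a $ b) = 1"
    using assms unfolding column_stochastic_def prob_simplex_def column_def by auto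
  show "0 \<le> A $ a $ b" "(\<Sum>a\<in>UNIV. A $ a $ b) = 1" by (fact *)+
  show "A $ a $ b \<le> 1"
    using member_le_sum[of a UNIV "\<lambda>a. A $ a $ b"] * by simp
qed

lemma column_stochasticI:
  assumes "\<And>a b. 0 \<le> A $ a $ b" "\<And>b. (\<Sum>a\<in>UNIV. A $ a $ b) = 1"
  shows "A \<in> column_stochastic"
  using assms unfolding column_stochastic_def prob_simplex_def column_def by auto

lemma sum_matrix_vector_mult_column_stochastic:
  assumes "A \<in> column_stochastic"
  shows "(\<Sum>a\<in>UNIV. (A *v v) $ a) = (\<Sum>b\<in>UNIV. v $ b)"
proof -
  have "(\<Sum>a\<in>UNIV. (A *v v) $ a) = (\<Sum>b\<in>UNIV. (\<Sum>a\<in>UNIV. A $ a $ b) * v $ b)"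
    unfolding matrix_vector_mult_def by (simp add: sum_distrib_right) (rule sum.swap)
  then show ?thesis using column_stochasticD[OF assms] by simp
qed

lemma column_stochastic_mult:
  assumes "A \<in> column_stochastic" "B \<in> column_stochastic"
  shows "A ** B \<in> column_stochastic"
proof (rule column_stochasticI)
  show "0 \<le> (A ** B) $ a $ b" for a b
    using column_stochasticD[OF assms(1)] column_stochasticD[OF assms(2)]
    unfolding matrix_matrix_mult_def by (simp add: sum_nonneg)
  have "(\<Sum>a\<in>UNIV. (A ** B) $ a $ b) = (\<Sum>c\<in>UNIV. (\<Sum>a\<in>UNIV. A $ a $ c) * B $ c $ b)" for b
    unfolding matrix_matrix_mult_def by (simp add: sum_distrib_right) (rule sum.swap)
  then show "(\<Sum>a\<in>UNIV. (A ** B) $ a $ b) = 1" for b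
    using column_stochasticD[OF assms(1)] column_stochasticD[OF assms(2)] by simp
qed

lemma left_product_column_stochastic:
  assumes "\<And>j. 1 \<le> j \<Longrightarrow> j \<le> m \<Longrightarrow> A j \<in> column_stochastic"
  shows "left_product A m \<in> column_stochastic"
  using assms
proof (induction m)
  case 0
  show ?case by (auto intro!: column_stochasticI simp: mat_def)
next
  case (Suc m)
  then show ?case by (auto intro!: column_stochastic_mult)
qed

text \<open>The first bound tests the operator norm on a difference of two axis vectors, whose norm
  is at most 2. For the second, zero-sum vectors see a row only up to an additive constant, so each
  of the \<open>k\<close> coordinates of the image is at most \<open>k\<close> times the largest
  difference within a row times the norm.\<close>

lemma column_diff_le_largest_singular_value:
  fixes A :: "real ^ 'k ^ 'k"
  assumes "CARD('k) \<ge> 2" and A: "A \<in> column_stochastic"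
  shows "\<bar>A $ c $ a - A $ c $ b\<bar> \<le> 2 * largest_singular_value_on zero_sum_space (\<lambda>v. A *v v)"
    and "\<exists>a b c. largest_singular_value_on zero_sum_space (\<lambda>v. A *v v) \<le>
      real CARD('k) ^ 2 * \<bar>A $ c $ a - A $ c $ b\<bar>"
proof -
  let ?m = "largest_singular_value_on zero_sum_space (\<lambda>v. A *v v)"
  have inv: "(\<lambda>v. A *v v) ` zero_sum_space \<subseteq> zero_sum_space"
    using sum_matrix_vector_mult_column_stochastic[OF A] unfolding zero_sum_space_def by auto
  note hyps = subspace_zero_sum_space zero_sum_space_nontrivial[OF assms(1)]
    matrix_vector_mul_linear[of A] inv
  let ?v = "axis a 1 - axis b 1 :: real ^ 'k"
  have "\<bar>A $ c $ a - A $ c $ b\<bar> = \<bar>(A *v ?v) $ c\<bar>"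
    by (simp add: matrix_vector_mult_diff_distrib matrix_vector_mult_basis column_def)
  also have "\<dots> \<le> norm (A *v ?v)" by (rule component_le_norm_cart)
  also have "\<dots> \<le> ?m * norm ?v"
    by (rule norm_le_largest_singular_value_on[OF hyps axis_diff_in_zero_sum_space])
  also have "\<dots> \<le> ?m * 2"
    using largest_singular_value_on_nonneg[OF hyps]
    by (intro mult_left_mono order_trans[OF norm_triangle_ineq4]) auto
  finally show "\<bar>A $ c $ a - A $ c $ b\<bar> \<le> 2 * ?m" by simp
next
  let ?m = "largest_singular_value_on zero_sum_space (\<lambda>v. A *v v)"
  have inv: "(\<lambda>v. A *v v) ` zero_sum_space \<subseteq> zero_sum_space"
    using sum_matrix_vector_mult_column_stochastic[OF A] unfolding zero_sum_space_def by auto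
  note hyps = subspace_zero_sum_space zero_sum_space_nontrivial[OF assms(1)]
    matrix_vector_mul_linear[of A] inv
  obtain v where v: "v \<in> zero_sum_space" "v \<noteq> 0" "norm (A *v v) = ?m * norm v"
    using largest_singular_value_on_attained[OF hyps] by blast
  define d where "d = Max (range (\<lambda>(a, b, c). \<bar>A $ c $ a - A $ c $ b\<bar>))"
  have "d \<in> range (\<lambda>(a, b, c). \<bar>A $ c $ a - A $ c $ b\<bar>)"
    unfolding d_def by (rule Max_in) auto
  then obtain a b c where d: "d = \<bar>A $ c $ a - A $ c $ b\<bar>" by auto
  have le: "\<bar>A $ c $ a - A $ c $ b\<bar> \<le> d" for a b c
    unfolding d_def by (rule Max_ge) (auto intro!: range_eqI[of _ _ "(a, b, c)"])
  have comp: "\<bar>(A *v v) $ c\<bar> \<le> real CARD('k) * (d * norm v)" for c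
  proof -
    have "(\<Sum>b\<in>UNIV. v $ b) = 0" using v unfolding zero_sum_space_def by simp
    \<comment> \<open>Subtracting the constant \<open>A $ c $ a\<close> from row \<open>c\<close>
      costs nothing because \<open>v\<close> has zero sum.\<close>
    then have "(A *v v) $ c = (\<Sum>b\<in>UNIV. (A $ c $ b - A $ c $ a) * v $ b)"
      by (simp add: matrix_vector_mult_def left_diff_distrib sum_subtractf flip: sum_distrib_left)
    also have "\<bar>\<dots>\<bar> \<le> (\<Sum>b\<in>UNIV. \<bar>(A $ c $ b - A $ c $ a) * v $ b\<bar>)" by (rule sum_abs)
    also have "\<dots> \<le> (\<Sum>b\<in>(UNIV :: 'k set). d * norm v)"
      using le component_le_norm_cart by (intro sum_mono) (auto simp: abs_mult intro!: mult_mono order_trans[OF _ le])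
    finally show ?thesis by simp
  qed
  have "?m * norm v \<le> (\<Sum>c\<in>UNIV. \<bar>(A *v v) $ c\<bar>)"
    using norm_le_l1_cart[of "A *v v"] v by simp
  also have "\<dots> \<le> real CARD('k) * (real CARD('k) * (d * norm v))"
    using sum_bounded_above[of UNIV "\<lambda>c. \<bar>(A *v v) $ c\<bar>", OF comp] by simp
  finally have "?m * norm v \<le> (real CARD('k) ^ 2 * d) * norm v"
    by (simp add: power2_eq_square mult_ac)
  then have "?m \<le> real CARD('k) ^ 2 * d" using v(2) by simp
  then show "\<exists>a b c. ?m \<le> real CARD('k) ^ 2 * \<bar>A $ c $ a - A $ c $ b\<bar>"
    unfolding d by blast
qed

section \<open>Total variation distance of product laws\<close>

lemma finite_words [simp]: "finite (words n :: (nat \<Rightarrow> 'k::finite) set)"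
  unfolding words_def by (intro finite_PiE) auto

lemma sum_words_prod:
  fixes g :: "nat \<Rightarrow> 'k::finite \<Rightarrow> 'a::comm_semiring_1"
  shows "(\<Sum>y\<in>words n. \<Prod>i=1..n. g i (y i)) = (\<Prod>i=1..n. \<Sum>c\<in>UNIV. g i c)"
  unfolding words_def by (rule prod_sum_PiE[symmetric]) auto

lemma tv_dist_commute: "tv_dist X p q = tv_dist X q p"
  unfolding tv_dist_def by (simp add: abs_minus_commute)

text \<open>Triangle inequality under the weights. It serves twice: with equilibrium weights, to
  replace equilibrium by initial words, and with one-step weights, to show monotonicity in
  time.\<close>

lemma tv_dist_convex:
  assumes "finite X" "finite Z" "\<And>z. z \<in> Z \<Longrightarrow> 0 \<le> w z" "sum w Z = 1"
    and "\<And>z. z \<in> Z \<Longrightarrow> tv_dist X p (q z) \<le> b"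
  shows "tv_dist X p (\<lambda>y. \<Sum>z\<in>Z. w z * q z y) \<le> b"
proof -
  have "tv_dist X p (\<lambda>y. \<Sum>z\<in>Z. w z * q z y) = 1 / 2 * (\<Sum>x\<in>X. \<bar>\<Sum>z\<in>Z. w z * (p x - q z x)\<bar>)"
    unfolding tv_dist_def using assms(4)
    by (simp add: right_diff_distrib sum_subtractf flip: sum_distrib_right)
  also have "\<dots> \<le> 1 / 2 * (\<Sum>x\<in>X. \<Sum>z\<in>Z. w z * \<bar>p x - q z x\<bar>)"
    using assms(3) by (intro mult_left_mono sum_mono order_trans[OF sum_abs]) (auto simp: abs_mult)
  also have "(\<Sum>x\<in>X. \<Sum>z\<in>Z. w z * \<bar>p x - q z x\<bar>) = (\<Sum>z\<in>Z. w z * (\<Sum>x\<in>X. \<bar>p x - q z x\<bar>))"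
    by (subst sum.swap) (simp add: sum_distrib_left)
  also have "1 / 2 * \<dots> = (\<Sum>z\<in>Z. w z * tv_dist X p (q z))"
    unfolding tv_dist_def by (simp add: sum_distrib_left mult_ac)
  also have "\<dots> \<le> (\<Sum>z\<in>Z. w z * b)"
    using assms by (intro sum_mono mult_left_mono) auto
  finally show ?thesis using assms(4) by (simp flip: sum_distrib_right)
qed

text \<open>Both totals are 1, so the surplus of \<open>p\<close> on \<open>A\<close> equals its
  deficit off \<open>A\<close>, and twice the surplus is bounded by the full sum of absolute
  differences.\<close>

lemma tv_dist_ge:
  assumes "finite X" "A \<subseteq> X" "sum p X = 1" "sum q X = 1"
  shows "sum p A - sum q A \<le> tv_dist X p q"
proof -
  have X: "X = A \<union> (X - A)" "A \<inter> (X - A) = {}" "finite A" "finite (X - A)"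
    using assms finite_subset by auto
  have "sum p A + sum p (X - A) = 1" "sum q A + sum q (X - A) = 1"
    using assms(3,4) X sum.union_disjoint by metis+
  then have "2 * (sum p A - sum q A) = (\<Sum>x\<in>A. p x - q x) + (\<Sum>x\<in>X - A. q x - p x)"
    by (simp add: sum_subtractf)
  also have "\<dots> \<le> (\<Sum>x\<in>A. \<bar>p x - q x\<bar>) + (\<Sum>x\<in>X - A. \<bar>p x - q x\<bar>)"
    by (intro add_mono sum_mono) auto
  also have "\<dots> = (\<Sum>x\<in>X. \<bar>p x - q x\<bar>)"
    using X sum.union_disjoint by metis
  finally show ?thesis unfolding tv_dist_def by simp
qed

lemma tv_dist_le_1:
  assumes "\<And>x. x \<in> X \<Longrightarrow> 0 \<le> p x" "\<And>x. x \<in> X \<Longrightarrow> 0 \<le> q x" "sum p X = 1" "sum q X = 1"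
  shows "tv_dist X p q \<le> 1"
proof -
  have "(\<Sum>x\<in>X. \<bar>p x - q x\<bar>) \<le> (\<Sum>x\<in>X. p x + q x)"
    using assms by (intro sum_mono) (smt (verit))
  then show ?thesis unfolding tv_dist_def using assms by (simp add: sum.distrib)
qed

text \<open>
  By Cauchy--Schwarz the total variation distance is bounded by the chi-squared distance, which
  tensorises.
\<close>

lemma tv_dist_prod_le:
  fixes p q :: "nat \<Rightarrow> 'k::finite \<Rightarrow> real"
  assumes p: "\<And>i. (\<Sum>c\<in>UNIV. p i c) = 1"
    and q: "\<And>i. (\<Sum>c\<in>UNIV. q i c) = 1" "\<And>i c. \<eta> \<le> q i c" "0 < \<eta>"
    and r: "\<And>i c. \<bar>p i c - q i c\<bar> \<le> r"
  shows "tv_dist (words n) (\<lambda>y. \<Prod>i=1..n. p i (y i)) (\<lambda>y. \<Prod>i=1..n. q i (y i))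
    \<le> 1 / 2 * sqrt (exp (real n * (real CARD('k) * r\<^sup>2 / \<eta>)) - 1)"
proof -
  let ?P = "\<lambda>y. \<Prod>i=1..n. p i (y i)" and ?Q = "\<lambda>y. \<Prod>i=1..n. q i (y i)"
  have q0: "0 < q i c" for i c using q(2,3) by (meson less_le_trans)
  have Q0: "0 < ?Q y" for y using q0 by (intro prod_pos) auto
  have sP: "sum ?P (words n) = 1" and sQ: "sum ?Q (words n) = 1"
    unfolding sum_words_prod by (simp_all add: p q)
  have chi1: "(\<Sum>c\<in>UNIV. (p i c)\<^sup>2 / q i c) \<le> exp (real CARD('k) * r\<^sup>2 / \<eta>)" for i
  proof -
    \<comment> \<open>Expanding around \<open>q\<close> makes the linear terms sum to 1, so only the
      squared differences remain above 1.\<close>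
    have "(p i c)\<^sup>2 / q i c = 2 * p i c - q i c + (p i c - q i c)\<^sup>2 / q i c" for c
      using q0[of i c] by (simp add: field_simps power2_eq_square)
    then have "(\<Sum>c\<in>UNIV. (p i c)\<^sup>2 / q i c) = 1 + (\<Sum>c\<in>UNIV. (p i c - q i c)\<^sup>2 / q i c)"
      using p q by (simp add: sum.distrib sum_subtractf flip: sum_distrib_left)
    also have "\<dots> \<le> 1 + (\<Sum>c\<in>(UNIV :: 'k set). r\<^sup>2 / \<eta>)"
      using q q0 r by (intro add_left_mono sum_mono frac_le) (auto intro!: abs_le_square_iff[THEN iffD1] intro: order_trans[OF _ abs_ge_self])
    \<comment> \<open>\<open>1 + x \<le> exp x\<close> lets the product over the \<open>n\<close>
      positions collapse into one exponential.\<close>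
    also have "\<dots> \<le> exp (real CARD('k) * r\<^sup>2 / \<eta>)"
      using exp_ge_add_one_self[of "real CARD('k) * r\<^sup>2 / \<eta>"] by simp
    finally show ?thesis .
  qed
  have "(\<Sum>y\<in>words n. (?P y)\<^sup>2 / ?Q y) = (\<Prod>i=1..n. \<Sum>c\<in>UNIV. (p i c)\<^sup>2 / q i c)"
    by (subst sum_words_prod[symmetric]) (simp add: prod_dividef prod_power_distrib)
  also have "\<dots> \<le> (\<Prod>i=1..n. exp (real CARD('k) * r\<^sup>2 / \<eta>))"
    using chi1 q0 by (intro prod_mono conjI sum_nonneg divide_nonneg_pos) auto
  also have "\<dots> = exp (real n * (real CARD('k) * r\<^sup>2 / \<eta>))"
    unfolding exp_of_nat_mult by simp
  finally have chi: "(\<Sum>y\<in>words n. (?P y)\<^sup>2 / ?Q y) \<le> exp (real n * (real CARD('k) * r\<^sup>2 / \<eta>))" .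
  have "(u - v)\<^sup>2 / v = u\<^sup>2 / v - 2 * u + v" if "0 < v" for u v :: real
    using that by (simp add: field_simps power2_eq_square)
  then have "(?P y - ?Q y)\<^sup>2 / ?Q y = (?P y)\<^sup>2 / ?Q y - 2 * ?P y + ?Q y" for y
    using Q0[of y] by blast
  then have chi': "(\<Sum>y\<in>words n. (?P y - ?Q y)\<^sup>2 / ?Q y) = (\<Sum>y\<in>words n. (?P y)\<^sup>2 / ?Q y) - 1"
    using sP sQ by (simp add: sum.distrib sum_subtractf flip: sum_distrib_left)
  \<comment> \<open>Splitting off the weight \<open>sqrt (?Q y)\<close> prepares Cauchy--Schwarz:
    its square sums to 1, and the other factor gives the chi-squared distance.\<close>
  have "(\<Sum>y\<in>words n. \<bar>?P y - ?Q y\<bar>) = (\<Sum>y\<in>words n. \<bar>?P y - ?Q y\<bar> / sqrt (?Q y) * sqrt (?Q y))"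
    by (intro sum.cong refl) (simp add: less_imp_neq[OF q0, symmetric])
  also have "\<dots> \<le> sqrt ((\<Sum>y\<in>words n. (\<bar>?P y - ?Q y\<bar> / sqrt (?Q y))\<^sup>2) * (\<Sum>y\<in>words n. (sqrt (?Q y))\<^sup>2))"
    by (intro real_le_rsqrt Cauchy_Schwarz_ineq_sum)
  also have "\<dots> = sqrt (\<Sum>y\<in>words n. (?P y - ?Q y)\<^sup>2 / ?Q y)"
    unfolding power_divide real_sqrt_pow2[OF less_imp_le[OF Q0]] sQ by simp
  also have "\<dots> \<le> sqrt (exp (real n * (real CARD('k) * r\<^sup>2 / \<eta>)) - 1)"
    using chi chi' by simp
  finally show ?thesis unfolding tv_dist_def by simp
qed

text \<open>The centred indicators at different positions are uncorrelated under the product law,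
  and each has second moment at most 1 because its absolute value is at most 1.\<close>

lemma variance_product_le:
  fixes p :: "nat \<Rightarrow> 'k::finite \<Rightarrow> real"
  assumes p: "\<And>i. (\<Sum>d\<in>UNIV. p i d) = 1" "\<And>i d. 0 \<le> p i d"
  shows "(\<Sum>y\<in>words n. (\<Prod>i=1..n. p i (y i)) * (\<Sum>i=1..n. w i * (of_bool (y i = c) - p i c))\<^sup>2)
    \<le> (\<Sum>i=1..n. (w i)\<^sup>2)"
proof -
  let ?P = "\<lambda>y. \<Prod>i=1..n. p i (y i)"
  define h where "h i d = of_bool (d = c) - p i c" for i d
  define v where "v i j = (\<Sum>y\<in>words n. ?P y * (h i (y i) * h j (y j)))" for i j
  have p1: "p i c \<le> 1" for i
    using member_le_sum[of c UNIV "p i"] p by simp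
  have h: "(\<Sum>d\<in>UNIV. p i d * h i d) = 0" "(h i d)\<^sup>2 \<le> 1" for i d
    using p p1[of i] unfolding h_def
    by (auto simp: right_diff_distrib sum_subtractf abs_square_le_1 simp flip: sum_distrib_right)
  \<comment> \<open>The two extra factors are spread over all positions as \<open>if\<close> factors
    equal to 1 elsewhere; in this form the sum over words factorises.\<close>
  have v: "v i j = (\<Prod>l=1..n. \<Sum>d\<in>UNIV. p l d * ((if l = i then h i d else 1) * (if l = j then h j d else 1)))"
    if "i \<in> {1..n}" "j \<in> {1..n}" for i j
    unfolding v_def
  proof (subst sum_words_prod[symmetric], intro sum.cong refl)
    fix y :: "nat \<Rightarrow> 'k"
    have "(\<Prod>l=1..n. if l = i then h i (y l) else 1) = h i (y i)"
      "(\<Prod>l=1..n. if l = j then h j (y l) else 1) = h j (y j)"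
      using that by simp_all
    then show "?P y * (h i (y i) * h j (y j)) =
      (\<Prod>l=1..n. p l (y l) * ((if l = i then h i (y l) else 1) * (if l = j then h j (y l) else 1)))"
      by (simp add: prod.distrib)
  qed
  \<comment> \<open>The factor at position \<open>i\<close> is the mean of a centred variable, so
    the whole product vanishes.\<close>
  have v_off: "v i j = 0" if "i \<in> {1..n}" "j \<in> {1..n}" "i \<noteq> j" for i j
    unfolding v[OF that(1,2)] using that h by (intro prod_zero bexI[of _ i]) auto
  have v_diag: "v i i \<le> 1" if "i \<in> {1..n}" for i
    unfolding v[OF that that]
  proof (intro prod_le_1 conjI)
    fix l
    let ?g = "\<lambda>d. (if l = i then h i d else 1) * (if l = i then h i d else 1)"
    have g: "0 \<le> ?g d" "?g d \<le> 1" for d using h(2)[of i d] by (auto simp: power2_eq_square)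
    show "0 \<le> (\<Sum>d\<in>UNIV. p l d * ?g d)"
      using mult_nonneg_nonneg[OF p(2) g(1)] by (rule sum_nonneg)
    have "(\<Sum>d\<in>UNIV. p l d * ?g d) \<le> (\<Sum>d\<in>UNIV. p l d * 1)"
      using mult_left_mono[OF g(2) p(2)] by (rule sum_mono)
    then show "(\<Sum>d\<in>UNIV. p l d * ?g d) \<le> 1" using p by simp
  qed
  have "(\<Sum>y\<in>words n. ?P y * (\<Sum>i=1..n. w i * h i (y i))\<^sup>2) =
      (\<Sum>y\<in>words n. \<Sum>i=1..n. \<Sum>j=1..n. w i * w j * (?P y * (h i (y i) * h j (y j))))"
    by (intro sum.cong refl)
      (simp add: power2_eq_square sum_product sum_distrib_left sum_distrib_right mult_ac)
  also have "\<dots> = (\<Sum>i=1..n. \<Sum>j=1..n. w i * w j * v i j)"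
    unfolding v_def sum_distrib_left
    by (subst sum.swap, intro sum.cong refl, subst sum.swap) simp
  also have "\<dots> = (\<Sum>i=1..n. \<Sum>j=1..n. if j = i then (w i)\<^sup>2 * v i i else 0)"
    by (intro sum.cong refl) (auto simp: v_off power2_eq_square)
  also have "\<dots> = (\<Sum>i=1..n. (w i)\<^sup>2 * v i i)" by (intro sum.cong refl) simp
  also have "\<dots> \<le> (\<Sum>i=1..n. (w i)\<^sup>2 * 1)"
    by (intro sum_mono mult_left_mono v_diag) auto
  finally show ?thesis by (simp add: h_def)
qed

text \<open>Chebyshev's inequality with the centring left to \<open>Z\<close>: the statistic itself
  in equilibrium, its deviation from a column difference under the chain.\<close>

lemma sum_markov:
  fixes q Z :: "'a \<Rightarrow> real"
  assumes "finite X" "\<And>y. y \<in> X \<Longrightarrow> 0 \<le> q y" "0 < t"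
    and A: "A \<subseteq> X" "\<And>y. y \<in> A \<Longrightarrow> t \<le> \<bar>Z y\<bar>"
  shows "sum q A \<le> (\<Sum>y\<in>X. q y * (Z y)\<^sup>2) / t\<^sup>2"
proof -
  have "sum q A * t\<^sup>2 \<le> (\<Sum>y\<in>A. q y * (Z y)\<^sup>2)"
    unfolding sum_distrib_right using assms A
    by (intro sum_mono mult_left_mono) (auto intro!: abs_le_square_iff[THEN iffD1] simp: subset_iff)
  also have "\<dots> \<le> (\<Sum>y\<in>X. q y * (Z y)\<^sup>2)"
    using assms A by (intro sum_mono2) auto
  finally show ?thesis using \<open>0 < t\<close> by (simp add: pos_le_divide_eq)
qed

section \<open>Faces of the simplex are Lebesgue null sets\<close>

lemma borel_measurable_matrix:
  fixes g :: "'x \<Rightarrow> real ^ 'k ^ 'k"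
  assumes "\<And>a b. (\<lambda>x. g x $ a $ b) \<in> borel_measurable N"
  shows "g \<in> borel_measurable N"
proof (subst borel_measurable_euclidean_space, intro ballI)
  fix i :: "real ^ 'k ^ 'k" assume "i \<in> Basis"
  then obtain a b where "i = axis a (axis b 1)" by (auto simp: Basis_vec_def)
  then show "(\<lambda>x. g x \<bullet> i) \<in> borel_measurable N" using assms by (simp add: inner_axis)
qed

lemma borel_measurable_entry [measurable]: "(\<lambda>A :: real ^ 'k ^ 'k. A $ a $ b) \<in> borel_measurable borel"
  by (intro borel_measurable_continuous_onI continuous_intros)

lemma borel_measurable_component [measurable]: "(\<lambda>s :: real ^ 'k. s $ a) \<in> borel_measurable borel"
  by (intro borel_measurable_continuous_onI continuous_intros)

text \<open>Fubini in the coordinate \<open>b0\<close>: its coefficient is nonzero, so every line in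
  that direction meets the hyperplane in at most one point.\<close>

lemma emeasure_PiM_lborel_hyperplane:
  fixes h :: "'b \<Rightarrow> real"
  assumes B: "finite B" and b0: "b0 \<in> B" "h b0 \<noteq> 0"
  shows "emeasure (PiM B (\<lambda>_. lborel)) {c \<in> space (PiM B (\<lambda>_. lborel)). (\<Sum>b\<in>B. c b * h b) = t} = 0"
proof -
  interpret product_sigma_finite "\<lambda>_ :: 'b. lborel :: real measure" by standard
  let ?B = "B - {b0}"
  let ?H = "{c \<in> space (PiM B (\<lambda>_. lborel)). (\<Sum>b\<in>B. c b * h b) = t}"
  have ins: "insert b0 ?B = B" using b0 by auto
  have [measurable]: "?H \<in> sets (PiM B (\<lambda>_. lborel))" by measurable
  have "emeasure (PiM B (\<lambda>_. lborel)) ?H = (\<integral>\<^sup>+c. indicator ?H c \<partial>PiM (insert b0 ?B) (\<lambda>_. lborel))"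
    unfolding ins by simp
  also have "\<dots> = (\<integral>\<^sup>+x. (\<integral>\<^sup>+y. indicator ?H (x(b0 := y)) \<partial>lborel) \<partial>PiM ?B (\<lambda>_. lborel))"
  proof (rule product_nn_integral_insert)
    show "indicator ?H \<in> borel_measurable (PiM (insert b0 ?B) (\<lambda>_. lborel))"
      unfolding ins by measurable
  qed (use B in auto)
  also have "\<dots> = (\<integral>\<^sup>+x. 0 \<partial>PiM ?B (\<lambda>_. lborel :: real measure))"
  proof (rule nn_integral_cong)
    fix x :: "'b \<Rightarrow> real"
    define r where "r = (\<Sum>b\<in>?B. x b * h b)"
    have "(\<integral>\<^sup>+y. indicator ?H (x(b0 := y)) \<partial>lborel) \<le> (\<integral>\<^sup>+y. indicator {(t - r) / h b0} y \<partial>lborel)"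
    proof (rule nn_integral_mono)
      fix y :: real
      have "(\<Sum>b\<in>B. (x(b0 := y)) b * h b) = y * h b0 + r"
        unfolding r_def using B b0 by (simp add: sum.remove[of B b0])
      then show "indicator ?H (x(b0 := y)) \<le> (indicator {(t - r) / h b0} y :: ennreal)"
        using b0(2) by (auto simp: indicator_def field_simps)
    qed
    then show "(\<integral>\<^sup>+y. indicator ?H (x(b0 := y)) \<partial>lborel) = 0" by simp
  qed
  finally show ?thesis by simp
qed

section \<open>Orthonormal coordinates for Lebesgue measure on the simplex\<close>

lemma orthonormal_basis_of_exists:
  fixes V :: "'a::euclidean_space set"
  assumes "subspace V"
  shows "\<exists>B. orthonormal_basis_of V B"
  using orthonormal_basis_subspace[OF assms] unfolding orthonormal_basis_of_def by metis

lemma orthonormal_basis_of_finite: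
  fixes V :: "'a::euclidean_space set"
  assumes "orthonormal_basis_of V B"
  shows "finite B"
proof -
  have "0 \<notin> B" using assms unfolding orthonormal_basis_of_def by force
  then show ?thesis
    using assms pairwise_orthogonal_independent independent_imp_finite
    unfolding orthonormal_basis_of_def by blast
qed

lemma orthonormal_basis_of_coordinate:
  fixes V :: "'a::euclidean_space set"
  assumes "orthonormal_basis_of V B" "b \<in> B"
  shows "(\<Sum>b'\<in>B. c b' *\<^sub>R b') \<bullet> b = c b"
proof -
  have "(\<Sum>b'\<in>B. c b' *\<^sub>R b') \<bullet> b = (\<Sum>b'\<in>B. if b' = b then c b else 0)"
    unfolding inner_sum_left using assms
    by (intro sum.cong) (auto simp: orthonormal_basis_of_def pairwise_def orthogonal_def norm_eq_1)
  then show ?thesis using assms orthonormal_basis_of_finite[OF assms(1)] by simp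
qed

lemma prob_simplex_borel [measurable]: "prob_simplex \<in> sets (borel :: (real ^ 'k) measure)"
  unfolding prob_simplex_def by measurable

text \<open>Discharges the \<open>SOME\<close> in \<open>lebesgue_subspace\<close>: of the chosen
  basis only orthonormality and its span are used afterwards.\<close>

lemma lebesgue_subspace_basis:
  fixes V :: "'a::euclidean_space set"
  assumes "subspace V"
  obtains B where "orthonormal_basis_of V B"
    "lebesgue_subspace V = distr (PiM B (\<lambda>_. lborel)) borel (\<lambda>c. \<Sum>b\<in>B. c b *\<^sub>R b)"
  using someI_ex[OF orthonormal_basis_of_exists[OF assms]] unfolding lebesgue_subspace_def Let_def
  by metis

text \<open>Unfolds the restriction and the two push-forwards at once, with one basis for all sets
  \<open>E\<close>, so that finiteness and null sets become questions about product Lebesgue measure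
  on coordinates.\<close>

lemma emeasure_lebesgue_simplex:
  obtains B :: "(real ^ 'k) set" where "orthonormal_basis_of zero_sum_space B"
    "\<And>E. E \<in> sets borel \<Longrightarrow> E \<subseteq> prob_simplex \<Longrightarrow> emeasure lebesgue_simplex E =
      emeasure (PiM B (\<lambda>_. lborel))
        {c \<in> space (PiM B (\<lambda>_. lborel)). (\<chi> i. 1 / real CARD('k)) + (\<Sum>b\<in>B. c b *\<^sub>R b) \<in> E}"
proof -
  obtain B :: "(real ^ 'k) set" where B: "orthonormal_basis_of zero_sum_space B"
    "lebesgue_subspace zero_sum_space = distr (PiM B (\<lambda>_. lborel)) borel (\<lambda>c. \<Sum>b\<in>B. c b *\<^sub>R b)"
    using lebesgue_subspace_basis[OF subspace_zero_sum_space] .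
  have m: "(\<lambda>c. \<Sum>b\<in>B. c b *\<^sub>R b) \<in> borel_measurable (PiM B (\<lambda>_. lborel))"
    by measurable
  have "emeasure lebesgue_simplex E =
      emeasure (PiM B (\<lambda>_. lborel))
        {c \<in> space (PiM B (\<lambda>_. lborel)). (\<chi> i. 1 / real CARD('k)) + (\<Sum>b\<in>B. c b *\<^sub>R b) \<in> E}"
    if "E \<in> sets borel" "E \<subseteq> prob_simplex" for E :: "(real ^ 'k) set"
  proof -
    have "emeasure lebesgue_simplex E = emeasure
        (distr (lebesgue_subspace zero_sum_space) borel (\<lambda>v. (\<chi> i. 1 / real CARD('k)) + v)) E"
      unfolding lebesgue_simplex_def using that by (intro emeasure_restrict_space) auto
    also have "distr (lebesgue_subspace zero_sum_space) borel (\<lambda>v. (\<chi> i. 1 / real CARD('k)) + v) =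
        distr (PiM B (\<lambda>_. lborel)) borel (\<lambda>c. (\<chi> i. 1 / real CARD('k)) + (\<Sum>b\<in>B. c b *\<^sub>R b))"
      unfolding B(2) by (subst distr_distr) (use m in \<open>auto simp: o_def\<close>)
    also have "emeasure \<dots> E = emeasure (PiM B (\<lambda>_. lborel))
        {c \<in> space (PiM B (\<lambda>_. lborel)). (\<chi> i. 1 / real CARD('k)) + (\<Sum>b\<in>B. c b *\<^sub>R b) \<in> E}"
      using that m by (subst emeasure_distr) (auto intro!: arg_cong2[where f = emeasure])
    finally show ?thesis .
  qed
  with B that show thesis by blast
qed

lemma sets_lebesgue_simplex [measurable_cong]:
  "sets lebesgue_simplex = sets (restrict_space borel prob_simplex)"
  unfolding lebesgue_simplex_def by (intro sets_restrict_space_cong) simp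

lemma space_lebesgue_simplex: "space lebesgue_simplex = prob_simplex"
  unfolding lebesgue_simplex_def by (simp add: space_restrict_space)

lemma norm_prob_simplex_le_1:
  assumes "s \<in> prob_simplex"
  shows "norm s \<le> 1"
  using norm_le_l1_cart[of s] assms unfolding prob_simplex_def by simp

text \<open>A point of the simplex and the barycentre both have norm at most 1, so the coordinates
  of their difference lie in a box of side 4. Finiteness makes the factors of the product over
  columns \<sigma>-finite.\<close>

lemma finite_measure_lebesgue_simplex: "finite_measure (lebesgue_simplex :: (real ^ 'k) measure)"
proof (rule finite_measureI)
  obtain B :: "(real ^ 'k) set" where B: "orthonormal_basis_of zero_sum_space B"
    and E: "\<And>E. E \<in> sets borel \<Longrightarrow> E \<subseteq> prob_simplex \<Longrightarrow> emeasure lebesgue_simplex E =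
      emeasure (PiM B (\<lambda>_. lborel))
        {c \<in> space (PiM B (\<lambda>_. lborel)). (\<chi> i. 1 / real CARD('k)) + (\<Sum>b\<in>B. c b *\<^sub>R b) \<in> E}"
    using emeasure_lebesgue_simplex by blast
  interpret product_sigma_finite "\<lambda>_ :: real ^ 'k. lborel :: real measure" by standard
  have finB: "finite B" using orthonormal_basis_of_finite[OF B] .
  let ?u = "(\<chi> i. 1 / real CARD('k)) :: real ^ 'k"
  have u: "?u \<in> prob_simplex" unfolding prob_simplex_def by simp
  have "emeasure lebesgue_simplex (space lebesgue_simplex :: (real ^ 'k) set) =
      emeasure (PiM B (\<lambda>_. lborel)) {c \<in> space (PiM B (\<lambda>_. lborel)). ?u + (\<Sum>b\<in>B. c b *\<^sub>R b) \<in> prob_simplex}"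
    unfolding space_lebesgue_simplex by (rule E) auto
  also have "\<dots> \<le> emeasure (PiM B (\<lambda>_. lborel)) (PiE B (\<lambda>_. {-2..2::real}))"
  proof (rule emeasure_mono)
    show "PiE B (\<lambda>_. {-2..2::real}) \<in> sets (PiM B (\<lambda>_. lborel))"
      using finB by (intro sets_PiM_I_finite) auto
    show "{c \<in> space (PiM B (\<lambda>_. lborel)). ?u + (\<Sum>b\<in>B. c b *\<^sub>R b) \<in> prob_simplex} \<subseteq> PiE B (\<lambda>_. {-2..2})"
    proof safe
      fix c b assume c: "c \<in> space (PiM B (\<lambda>_. lborel :: real measure))"
        "?u + (\<Sum>b\<in>B. c b *\<^sub>R b) \<in> prob_simplex"
      have "\<bar>c b\<bar> \<le> 2" if "b \<in> B"
      proof -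
        have "\<bar>c b\<bar> = \<bar>((?u + (\<Sum>b\<in>B. c b *\<^sub>R b)) - ?u) \<bullet> b\<bar>"
          using orthonormal_basis_of_coordinate[OF B that] by simp
        also have "\<dots> \<le> norm ((?u + (\<Sum>b\<in>B. c b *\<^sub>R b)) - ?u) * norm b" by (rule Cauchy_Schwarz_ineq2)
        also have "\<dots> = norm ((?u + (\<Sum>b\<in>B. c b *\<^sub>R b)) - ?u)"
          using B that unfolding orthonormal_basis_of_def by simp
        also have "\<dots> \<le> norm (?u + (\<Sum>b\<in>B. c b *\<^sub>R b)) + norm ?u" by (rule norm_triangle_ineq4)
        also have "\<dots> \<le> 2" using norm_prob_simplex_le_1[OF c(2)] norm_prob_simplex_le_1[OF u] by simp
        finally show ?thesis .
      qed
      then show "b \<in> B \<Longrightarrow> c b \<in> {-2..2}" by auto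
      show "b \<notin> B \<Longrightarrow> c b = undefined" using c by (simp add: space_PiM PiE_def extensional_def)
    qed
  qed
  also have "\<dots> < \<infinity>"
    using finB by (subst emeasure_PiM) (auto simp: ennreal_prod_eq_top prod_constant power_less_top_ennreal)
  finally show "emeasure lebesgue_simplex (space lebesgue_simplex :: (real ^ 'k) set) \<noteq> \<infinity>" by simp
qed

text \<open>In coordinates the face lies in a hyperplane. The hyperplane is proper because some
  basis vector has a nonzero entry at \<open>a\<close>; otherwise the span would miss
  \<open>axis a 1 - axis b 1\<close>, where a second letter \<open>b\<close> exists since
  \<open>k \<ge> 2\<close>.\<close>

lemma emeasure_lebesgue_simplex_face:
  fixes a :: "'k::finite"
  assumes "CARD('k) \<ge> 2"
  shows "emeasure lebesgue_simplex {s \<in> prob_simplex. s $ a = 0} = 0"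
proof -
  obtain B :: "(real ^ 'k) set" where B: "orthonormal_basis_of zero_sum_space B"
    and E: "\<And>E. E \<in> sets borel \<Longrightarrow> E \<subseteq> prob_simplex \<Longrightarrow> emeasure lebesgue_simplex E =
      emeasure (PiM B (\<lambda>_. lborel))
        {c \<in> space (PiM B (\<lambda>_. lborel)). (\<chi> i. 1 / real CARD('k)) + (\<Sum>b\<in>B. c b *\<^sub>R b) \<in> E}"
    using emeasure_lebesgue_simplex by blast
  have "\<exists>b0\<in>B. b0 $ a \<noteq> 0"
  proof (rule ccontr)
    assume "\<not> ?thesis"
    then have "B \<subseteq> {v. v $ a = 0}" by auto
    moreover have "subspace {v :: real ^ 'k. v $ a = 0}" by (simp add: subspace_def)
    ultimately have V: "zero_sum_space \<subseteq> {v :: real ^ 'k. v $ a = 0}"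
      using B span_minimal unfolding orthonormal_basis_of_def by metis
    obtain b :: 'k where "b \<noteq> a" using assms by (metis card_2_iff' One_nat_def Suc_1 UNIV_I card_le_Suc0_iff_eq finite not_less_eq_eq)
    then show False
      using V axis_diff_in_zero_sum_space[of a b] by (auto simp: axis_def)
  qed
  then obtain b0 where b0: "b0 \<in> B" "b0 $ a \<noteq> 0" by blast
  have "emeasure lebesgue_simplex {s \<in> prob_simplex. s $ a = 0} =
      emeasure (PiM B (\<lambda>_. lborel)) {c \<in> space (PiM B (\<lambda>_. lborel)).
        (\<chi> i. 1 / real CARD('k)) + (\<Sum>b\<in>B. c b *\<^sub>R b) \<in> {s \<in> prob_simplex. s $ a = 0}}"
    by (rule E) auto
  also have "\<dots> \<le> emeasure (PiM B (\<lambda>_. lborel))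
      {c \<in> space (PiM B (\<lambda>_. lborel)). (\<Sum>b\<in>B. c b * b $ a) = - 1 / real CARD('k)}"
    by (rule emeasure_mono) (auto simp: eq_neg_iff_add_eq_0 add.commute)
  also have "\<dots> = 0"
    using orthonormal_basis_of_finite[OF B] b0 by (intro emeasure_PiM_lborel_hyperplane[of B b0])
  finally show ?thesis by simp
qed

lemma AE_lebesgue_column_stochastic_entry_neq_0:
  fixes a b :: "'k::finite"
  assumes "CARD('k) \<ge> 2"
  shows "AE A in lebesgue_column_stochastic. A $ a $ b \<noteq> 0"
proof -
  interpret product_sigma_finite "\<lambda>_ :: 'k. lebesgue_simplex :: (real ^ 'k) measure"
    using finite_measure_lebesgue_simplex
    by (auto simp: product_sigma_finite_def intro: finite_measure.axioms)
  let ?P = "PiM (UNIV :: 'k set) (\<lambda>_. lebesgue_simplex :: (real ^ 'k) measure)"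
  let ?g = "\<lambda>c. (\<chi> a b. c b $ a) :: real ^ 'k ^ 'k"
  have comp [measurable]: "(\<lambda>s :: real ^ 'k. s $ a) \<in> borel_measurable lebesgue_simplex" for a
    by (subst measurable_cong_sets[OF sets_lebesgue_simplex refl], rule measurable_restrict_space1) simp
  have "?g \<in> borel_measurable ?P"
    by (rule borel_measurable_matrix) simp
  moreover have "?g \<in> space ?P \<rightarrow> column_stochastic"
    by (auto simp: space_PiM space_lebesgue_simplex PiE_def column_stochastic_def column_def)
  ultimately have g: "?g \<in> measurable ?P (restrict_space borel column_stochastic)"
    by (rule measurable_restrict_space2[rotated])
  \<comment> \<open>The matrices with entry 0 at \<open>(a, b)\<close> form a box: a null face in
    column \<open>b\<close> and the whole simplex in every other column.\<close>
  define F where "F b' = (if b' = b then {s :: real ^ 'k \<in> prob_simplex. s $ a = 0} else prob_simplex)" for b'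
  have "{s :: real ^ 'k \<in> prob_simplex. s $ a = 0} \<in> sets lebesgue_simplex"
    by (auto simp: sets_lebesgue_simplex sets_restrict_space)
  moreover have "(prob_simplex :: (real ^ 'k) set) \<in> sets lebesgue_simplex"
    using sets.top[of lebesgue_simplex] by (simp add: space_lebesgue_simplex)
  ultimately have F: "F b' \<in> sets lebesgue_simplex" for b'
    unfolding F_def by auto
  have "emeasure ?P (PiE UNIV F) = (\<Prod>b'\<in>UNIV. emeasure lebesgue_simplex (F b'))"
    using F by (intro emeasure_PiM) auto
  also have "\<dots> = 0"
    using emeasure_lebesgue_simplex_face[OF assms, of a]
    by (intro prod_zero) (auto intro!: bexI[of _ b] simp: F_def)
  finally have "emeasure ?P (PiE UNIV F) = 0" .
  moreover have "PiE UNIV F \<in> sets ?P" using F by (intro sets_PiM_I_finite) auto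
  moreover have "{c \<in> space ?P. \<not> ?g c $ a $ b \<noteq> 0} \<subseteq> PiE UNIV F"
    by (auto simp: space_PiM space_lebesgue_simplex F_def PiE_def)
  ultimately have "AE c in ?P. ?g c $ a $ b \<noteq> 0"
    by (intro AE_I)
  moreover have [measurable]: "(\<lambda>A :: real ^ 'k ^ 'k. A $ a $ b) \<in> borel_measurable (restrict_space borel column_stochastic)"
    by (rule measurable_restrict_space1) measurable
  moreover have "{A \<in> space (restrict_space borel column_stochastic). A $ a $ b \<noteq> 0} \<in> sets (restrict_space borel column_stochastic)"
    by measurable
  ultimately show ?thesis
    unfolding lebesgue_column_stochastic_def by (subst AE_distr_iff[OF g])
qed

section \<open>The chain as a mixture of product laws\<close>

lemma left_product_cong:
  assumes "\<And>j. 1 \<le> j \<Longrightarrow> j \<le> m \<Longrightarrow> A j = B j"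
  shows "left_product A m = left_product B m"
  using assms by (induction m) auto

lemma tv_dist_cong:
  assumes "\<And>x. x \<in> X \<Longrightarrow> p x = p' x" "\<And>x. x \<in> X \<Longrightarrow> q x = q' x"
  shows "tv_dist X p q = tv_dist X p' q'"
  unfolding tv_dist_def using assms by simp

lemma abs_diff_le_tv_dist:
  assumes "finite X" "x \<in> X"
  shows "\<bar>p x - q x\<bar> \<le> 2 * tv_dist X p q"
  unfolding tv_dist_def using member_le_sum[of x X "\<lambda>x. \<bar>p x - q x\<bar>"] assms by simp

lemma words_eqI:
  assumes "x \<in> words n" "y \<in> words n" "\<And>i. i \<in> {1..n} \<Longrightarrow> x i = y i"
  shows "x = y"
  using assms unfolding words_def by (intro PiE_ext) auto

text \<open>The integrand of \<open>efcp_kernel\<close>. For a fixed matrix it is a product law over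
  positions, a structure that is lost on averaging over the matrix.\<close>

definition word_prob :: "real ^ 'k ^ 'k \<Rightarrow> nat \<Rightarrow> (nat \<Rightarrow> 'k) \<Rightarrow> (nat \<Rightarrow> 'k) \<Rightarrow> real" where
  "word_prob A n x y = (\<Prod>i=1..n. A $ y i $ x i)"

lemma word_prob_nonneg: "A \<in> column_stochastic \<Longrightarrow> 0 \<le> word_prob A n x y"
  unfolding word_prob_def by (intro prod_nonneg) (simp add: column_stochasticD)

lemma word_prob_le_1: "A \<in> column_stochastic \<Longrightarrow> word_prob A n x y \<le> 1"
  unfolding word_prob_def by (intro prod_le_1) (simp add: column_stochasticD)

lemma sum_word_prob: "A \<in> column_stochastic \<Longrightarrow> (\<Sum>y\<in>words n. word_prob A n x y) = 1"
  unfolding word_prob_def by (subst sum_words_prod) (simp add: column_stochasticD)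

text \<open>The positions move independently when the matrices are fixed, so two steps multiply the
  matrices position by position; the matrix applied first stands on the right.\<close>

lemma word_prob_mult:
  "(\<Sum>z\<in>words n. word_prob B n x z * word_prob A n z y) = word_prob (A ** B) n x y"
proof -
  have "(\<Sum>z\<in>words n. word_prob B n x z * word_prob A n z y) =
      (\<Sum>z\<in>words n. \<Prod>i=1..n. B $ z i $ x i * A $ y i $ z i)"
    unfolding word_prob_def by (simp add: prod.distrib)
  also have "\<dots> = (\<Prod>i=1..n. \<Sum>c\<in>UNIV. B $ c $ x i * A $ y i $ c)"
    by (rule sum_words_prod)
  finally show ?thesis unfolding word_prob_def matrix_matrix_mult_def by (simp add: mult.commute)
qed

lemma word_prob_mat_1:
  assumes "x \<in> words n" "y \<in> words n"
  shows "word_prob (mat 1) n x y = (if y = x then 1 else 0)"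
proof (cases "y = x")
  case False
  then obtain i where "i \<in> {1..n}" "y i \<noteq> x i" using words_eqI[OF assms] by metis
  then show ?thesis using False unfolding word_prob_def mat_def by (auto intro!: prod_zero bexI[of _ i])
qed (simp add: word_prob_def mat_def)

text \<open>Dominated convergence for the indicators. It turns almost sure statements without a rate
  into the small exceptional probabilities of the estimates.\<close>

lemma (in prob_space) prob_tendsto_0:
  assumes E: "\<And>j. E j \<in> events" and ae: "AE \<omega> in M. \<forall>\<^sub>F j in sequentially. \<omega> \<notin> E j"
  shows "(\<lambda>j. prob (E j)) \<longlonglongrightarrow> 0"
proof -
  have "(\<lambda>j. \<integral>\<omega>. indicator (E j) \<omega> \<partial>M) \<longlonglongrightarrow> (\<integral>\<omega>. 0 \<partial>M :: real)"
  proof (rule integral_dominated_convergence[where w = "\<lambda>_. 1"])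
    show "AE \<omega> in M. (\<lambda>j. indicator (E j) \<omega> :: real) \<longlonglongrightarrow> 0"
      using ae
    proof (rule AE_mp, intro AE_I2 impI)
      fix \<omega> assume "\<forall>\<^sub>F j in sequentially. \<omega> \<notin> E j"
      then have "\<forall>\<^sub>F j in sequentially. indicator (E j) \<omega> = (0 :: real)"
        by (auto elim!: eventually_mono)
      then show "(\<lambda>j. indicator (E j) \<omega> :: real) \<longlonglongrightarrow> 0" by (rule tendsto_eventually)
    qed
  qed (use E in \<open>auto simp: indicator_def\<close>)
  then show ?thesis using E by simp
qed

section \<open>Products of independent, identically distributed column-stochastic matrices\<close>

locale efcp_walk = prob_space M for M :: "'w measure" +
  fixes Sig :: "(real ^ 'k ^ 'k) measure" and S :: "nat \<Rightarrow> 'w \<Rightarrow> real ^ 'k ^ 'k"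
  assumes Sig_borel: "sets Sig = sets (restrict_space borel column_stochastic)"
    and S_indep: "indep_vars (\<lambda>_. Sig) S {1..}"
    and S_law: "\<And>m. m \<ge> 1 \<Longrightarrow> distr M Sig (S m) = Sig"
begin

abbreviation Q :: "nat \<Rightarrow> 'w \<Rightarrow> real ^ 'k ^ 'k" where
  "Q m \<omega> \<equiv> left_product (\<lambda>j. S j \<omega>) m"

lemma space_Sig: "space Sig = column_stochastic"
  using sets_eq_imp_space_eq[OF Sig_borel] by (simp add: space_restrict_space)

lemma measurable_Sig_entry [measurable]: "(\<lambda>A. A $ a $ b) \<in> borel_measurable Sig"
  by (subst measurable_cong_sets[OF Sig_borel refl], rule measurable_restrict_space1) measurable

lemma S_measurable: "1 \<le> m \<Longrightarrow> S m \<in> measurable M Sig"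
  using S_indep unfolding indep_vars_def by auto

lemma S_column_stochastic: "1 \<le> m \<Longrightarrow> \<omega> \<in> space M \<Longrightarrow> S m \<omega> \<in> column_stochastic"
  using measurable_space[OF S_measurable] space_Sig by blast

lemma Q_column_stochastic: "\<omega> \<in> space M \<Longrightarrow> Q m \<omega> \<in> column_stochastic"
  by (rule left_product_column_stochastic) (rule S_column_stochastic)

lemma measurable_S_entry [measurable]: "(\<lambda>\<omega>. S (Suc m) \<omega> $ a $ b) \<in> borel_measurable M"
  using measurable_compose[OF S_measurable measurable_Sig_entry] by simp

lemma measurable_Q_entry [measurable]: "(\<lambda>\<omega>. Q m \<omega> $ a $ b) \<in> borel_measurable M"
proof (induction m arbitrary: a b)
  case (Suc m)
  note Suc [measurable]
  show ?case by (simp add: matrix_matrix_mult_def)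
qed simp

text \<open>Measurability in the tuple of matrices rather than in \<omega>: independence of
  \<open>Q m\<close> from \<open>S (Suc m)\<close> requires \<open>Q m\<close> to be a measurable
  function of the first \<open>m\<close> matrices.\<close>

lemma measurable_left_product_entry:
  assumes "m \<le> N"
  shows "(\<lambda>A. left_product A m $ a $ b) \<in> borel_measurable (PiM {1..N} (\<lambda>_. Sig))"
  using assms
proof (induction m arbitrary: a b)
  case (Suc m)
  have IH [measurable]: "(\<lambda>A. left_product A m $ a $ b) \<in> borel_measurable (PiM {1..N} (\<lambda>_. Sig))" for a b
    using Suc by simp
  have [measurable]: "(\<lambda>A. A (Suc m) $ a $ b) \<in> borel_measurable (PiM {1..N} (\<lambda>_. Sig))" for a b
    using Suc.prems by (intro measurable_compose[OF _ measurable_Sig_entry] measurable_component_singleton) auto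
  show ?case by (simp add: matrix_matrix_mult_def del: One_nat_def)
qed simp

lemma measurable_word_prob_Q [measurable]: "(\<lambda>\<omega>. word_prob (Q m \<omega>) n x y) \<in> borel_measurable M"
  unfolding word_prob_def by measurable

lemma integrable_word_prob_Q: "integrable M (\<lambda>\<omega>. word_prob (Q m \<omega>) n x y)"
  using word_prob_nonneg[OF Q_column_stochastic] word_prob_le_1[OF Q_column_stochastic]
  by (intro integrable_const_bound[where B = 1]) auto

lemma integrable_word_prob_S: "integrable M (\<lambda>\<omega>. word_prob (S (Suc m) \<omega>) n x y)"
  using word_prob_nonneg[OF S_column_stochastic] word_prob_le_1[OF S_column_stochastic]
  by (intro integrable_const_bound[where B = 1]) (auto simp: word_prob_def[abs_def])

lemma efcp_kernel_eq: "efcp_kernel Sig n x y = (\<integral>\<omega>. word_prob (S (Suc m) \<omega>) n x y \<partial>M)"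
proof -
  have "(\<integral>A. word_prob A n x y \<partial>(distr M Sig (S (Suc m)))) = (\<integral>\<omega>. word_prob (S (Suc m) \<omega>) n x y \<partial>M)"
    using S_measurable by (intro integral_distr) (auto simp: word_prob_def)
  then show ?thesis using S_law by (simp add: efcp_kernel_def word_prob_def)
qed

lemma integral_word_prob_mult:
  shows "(\<integral>\<omega>. word_prob (Q m \<omega>) n x z * word_prob (S (Suc m) \<omega>) n z y \<partial>M) =
      (\<integral>\<omega>. word_prob (Q m \<omega>) n x z \<partial>M) * (\<integral>\<omega>. word_prob (S (Suc m) \<omega>) n z y \<partial>M)"
    and "integrable M (\<lambda>\<omega>. word_prob (Q m \<omega>) n x z * word_prob (S (Suc m) \<omega>) n z y)"
proof -
  have ind: "indep_var (PiM {1..m} (\<lambda>_. Sig)) (\<lambda>\<omega>. restrict (\<lambda>i. S i \<omega>) {1..m})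
      (PiM {Suc m} (\<lambda>_. Sig)) (\<lambda>\<omega>. restrict (\<lambda>i. S i \<omega>) {Suc m})"
    by (rule indep_var_restrict[OF S_indep]) auto
  have "(\<lambda>A. word_prob (left_product A m) n x z) \<in> borel_measurable (PiM {1..m} (\<lambda>_. Sig))"
    unfolding word_prob_def using measurable_left_product_entry[of m m] by measurable
  moreover have "(\<lambda>A. A (Suc m) $ a $ b) \<in> borel_measurable (PiM {Suc m} (\<lambda>_. Sig))" for a b
    by (intro measurable_compose[OF _ measurable_Sig_entry] measurable_component_singleton) auto
  then have "(\<lambda>A. word_prob (A (Suc m)) n z y) \<in> borel_measurable (PiM {Suc m} (\<lambda>_. Sig))"
    unfolding word_prob_def by measurable
  ultimately have "indep_var
      borel ((\<lambda>A. word_prob (left_product A m) n x z) \<circ> (\<lambda>\<omega>. restrict (\<lambda>i. S i \<omega>) {1..m}))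
      borel ((\<lambda>A. word_prob (A (Suc m)) n z y) \<circ> (\<lambda>\<omega>. restrict (\<lambda>i. S i \<omega>) {Suc m}))"
    by (rule indep_var_compose[OF ind])
  \<comment> \<open>\<open>left_product\<close> at \<open>m\<close> reads only the indices from 1 to
    \<open>m\<close>, so the restriction is invisible to it.\<close>
  moreover have "left_product (restrict (\<lambda>i. S i \<omega>) {1..m}) m = Q m \<omega>" for \<omega>
    by (rule left_product_cong) auto
  ultimately have ind': "indep_var borel (\<lambda>\<omega>. word_prob (Q m \<omega>) n x z)
      borel (\<lambda>\<omega>. word_prob (S (Suc m) \<omega>) n z y)"
    by (simp add: o_def)
  show "(\<integral>\<omega>. word_prob (Q m \<omega>) n x z * word_prob (S (Suc m) \<omega>) n z y \<partial>M) =
      (\<integral>\<omega>. word_prob (Q m \<omega>) n x z \<partial>M) * (\<integral>\<omega>. word_prob (S (Suc m) \<omega>) n z y \<partial>M)"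
    by (rule indep_var_lebesgue_integral[OF ind' integrable_word_prob_Q integrable_word_prob_S])
  show "integrable M (\<lambda>\<omega>. word_prob (Q m \<omega>) n x z * word_prob (S (Suc m) \<omega>) n z y)"
    by (rule indep_var_integrable[OF ind' integrable_word_prob_Q integrable_word_prob_S])
qed

text \<open>The chain averaged over the matrices is a mixture of product laws, one for each
  realisation of \<open>Q m\<close>. The induction step needs that the new matrix is independent of
  the past, which lets the product of integrals become the integral of a product.\<close>

lemma efcp_law_eq:
  assumes "x \<in> words n" "y \<in> words n"
  shows "efcp_law Sig n x m y = (\<integral>\<omega>. word_prob (Q m \<omega>) n x y \<partial>M)"
  using assms(2)
proof (induction m arbitrary: y)
  case 0
  then show ?case using assms(1) by (simp add: word_prob_mat_1 prob_space)
next
  case (Suc m)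
  have "efcp_law Sig n x (Suc m) y = (\<Sum>z\<in>words n. (\<integral>\<omega>. word_prob (Q m \<omega>) n x z \<partial>M) *
      (\<integral>\<omega>. word_prob (S (Suc m) \<omega>) n z y \<partial>M))"
    using Suc.IH by (simp add: efcp_kernel_eq[of n _ y m])
  also have "\<dots> = (\<integral>\<omega>. (\<Sum>z\<in>words n. word_prob (Q m \<omega>) n x z * word_prob (S (Suc m) \<omega>) n z y) \<partial>M)"
    using integral_word_prob_mult by simp
  finally show ?case by (simp add: word_prob_mult)
qed

lemma sum_efcp_law_eq:
  assumes "x \<in> words n" "X \<subseteq> words n"
  shows "(\<Sum>y\<in>X. efcp_law Sig n x m y * g y) = (\<integral>\<omega>. (\<Sum>y\<in>X. word_prob (Q m \<omega>) n x y * g y) \<partial>M)"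
proof -
  have "(\<Sum>y\<in>X. efcp_law Sig n x m y * g y) = (\<Sum>y\<in>X. \<integral>\<omega>. word_prob (Q m \<omega>) n x y * g y \<partial>M)"
    using assms by (intro sum.cong) (auto simp: efcp_law_eq)
  then show ?thesis using integrable_word_prob_Q by simp
qed

lemma efcp_law_nonneg: "x \<in> words n \<Longrightarrow> y \<in> words n \<Longrightarrow> 0 \<le> efcp_law Sig n x m y"
  using word_prob_nonneg[OF Q_column_stochastic] by (simp add: efcp_law_eq integral_nonneg_AE)

lemma sum_efcp_law: "x \<in> words n \<Longrightarrow> (\<Sum>y\<in>words n. efcp_law Sig n x m y) = 1"
proof -
  assume "x \<in> words n"
  then have "(\<Sum>y\<in>words n. efcp_law Sig n x m y) = (\<integral>\<omega>. (\<Sum>y\<in>words n. word_prob (Q m \<omega>) n x y) \<partial>M)"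
    using sum_efcp_law_eq[of x n "words n" m "\<lambda>_. 1"] by simp
  also have "\<dots> = (\<integral>\<omega>. 1 \<partial>M)"
    using sum_word_prob[OF Q_column_stochastic] by (intro Bochner_Integration.integral_cong) auto
  finally show ?thesis by (simp add: prob_space)
qed

lemma efcp_law_add:
  assumes "y \<in> words n"
  shows "efcp_law Sig n x (m + j) y = (\<Sum>z\<in>words n. efcp_law Sig n x m z * efcp_law Sig n z j y)"
  using assms
proof (induction j arbitrary: y)
  case 0
  then show ?case by (simp add: if_distrib[of "\<lambda>t. _ * t"] cong: if_cong)
next
  case (Suc j)
  have "efcp_law Sig n x (m + Suc j) y =
      (\<Sum>u\<in>words n. (\<Sum>z\<in>words n. efcp_law Sig n x m z * efcp_law Sig n z j u) * efcp_kernel Sig n u y)"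
    using Suc.IH by simp
  also have "\<dots> = (\<Sum>z\<in>words n. efcp_law Sig n x m z * (\<Sum>u\<in>words n. efcp_law Sig n z j u * efcp_kernel Sig n u y))"
    unfolding sum_distrib_left sum_distrib_right by (subst sum.swap) (simp add: mult_ac)
  finally show ?case by simp
qed

text \<open>Both chains are driven by the same matrices, so the triangle inequality can be applied
  inside the integral.\<close>

lemma tv_dist_efcp_law_le:
  assumes "x \<in> words n" "x' \<in> words n"
  shows "tv_dist (words n) (efcp_law Sig n x m) (efcp_law Sig n x' m) \<le>
    (\<integral>\<omega>. tv_dist (words n) (word_prob (Q m \<omega>) n x) (word_prob (Q m \<omega>) n x') \<partial>M)"
proof -
  have int: "integrable M (\<lambda>\<omega>. \<bar>word_prob (Q m \<omega>) n x y - word_prob (Q m \<omega>) n x' y\<bar>)" for y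
    using integrable_word_prob_Q by auto
  have "(\<Sum>y\<in>words n. \<bar>efcp_law Sig n x m y - efcp_law Sig n x' m y\<bar>) \<le>
      (\<Sum>y\<in>words n. \<integral>\<omega>. \<bar>word_prob (Q m \<omega>) n x y - word_prob (Q m \<omega>) n x' y\<bar> \<partial>M)"
  proof (rule sum_mono)
    fix y :: "nat \<Rightarrow> 'k" assume "y \<in> words n"
    then have "efcp_law Sig n x m y - efcp_law Sig n x' m y =
        (\<integral>\<omega>. word_prob (Q m \<omega>) n x y - word_prob (Q m \<omega>) n x' y \<partial>M)"
      using assms integrable_word_prob_Q by (simp add: efcp_law_eq)
    then show "\<bar>efcp_law Sig n x m y - efcp_law Sig n x' m y\<bar> \<le>
        (\<integral>\<omega>. \<bar>word_prob (Q m \<omega>) n x y - word_prob (Q m \<omega>) n x' y\<bar> \<partial>M)"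
      using integral_abs_bound[of M "\<lambda>\<omega>. word_prob (Q m \<omega>) n x y - word_prob (Q m \<omega>) n x' y"]
      by (simp only:)
  qed
  then show ?thesis unfolding tv_dist_def using int by simp
qed

end

section \<open>Contraction and the stationary distribution\<close>

context efcp_walk
begin

text \<open>Entries of \<open>S m\<close> rather than of \<open>Q m\<close>: the probability is then
  the same for every \<open>m \<ge> 1\<close>, and a lower bound for \<open>S m\<close> is inherited
  by \<open>Q m\<close>.\<close>

definition small_entry :: "real \<Rightarrow> nat \<Rightarrow> 'w set" where
  "small_entry \<eta> m = {\<omega> \<in> space M. \<exists>a b. S m \<omega> $ a $ b < \<eta>}"

definition far_columns :: "real \<Rightarrow> nat \<Rightarrow> 'w set" where
  "far_columns r m = {\<omega> \<in> space M. \<exists>a b c. r < \<bar>Q m \<omega> $ c $ a - Q m \<omega> $ c $ b\<bar>}"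

text \<open>The inequality is strict, so that off this event some difference is at least
  \<open>r\<close>, as the lower bound wants; off \<open>far_columns\<close> all differences are at
  most \<open>r\<close>, as the upper bound wants.\<close>

definition near_columns :: "real \<Rightarrow> nat \<Rightarrow> 'w set" where
  "near_columns r m = {\<omega> \<in> space M. \<forall>a b c. \<bar>Q m \<omega> $ c $ a - Q m \<omega> $ c $ b\<bar> < r}"

lemma small_entry_events [measurable]: "1 \<le> m \<Longrightarrow> small_entry \<eta> m \<in> events"
  unfolding small_entry_def by (cases m) simp_all

lemma far_columns_events [measurable]: "far_columns r m \<in> events"
  unfolding far_columns_def by measurable

lemma near_columns_events [measurable]: "near_columns r m \<in> events"
  unfolding near_columns_def by measurable

text \<open>An entry of \<open>Q m\<close> is an average of a row of \<open>S m\<close>, weighted by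
  a column of the preceding product, and that column is a probability vector.\<close>

lemma Q_entry_ge:
  assumes "1 \<le> m" "\<omega> \<in> space M" "\<And>a b. \<eta> \<le> S m \<omega> $ a $ b"
  shows "\<eta> \<le> Q m \<omega> $ a $ b"
proof -
  obtain j where m: "m = Suc j" using assms(1) by (cases m) auto
  have "\<eta> = (\<Sum>c\<in>UNIV. \<eta> * Q j \<omega> $ c $ b)"
    using column_stochasticD(2)[OF Q_column_stochastic[OF assms(2)]] by (simp flip: sum_distrib_left)
  also have "\<dots> \<le> (\<Sum>c\<in>UNIV. S m \<omega> $ a $ c * Q j \<omega> $ c $ b)"
    using assms(3) column_stochasticD(1)[OF Q_column_stochastic[OF assms(2)]]
    by (intro sum_mono mult_right_mono) auto
  finally show ?thesis by (simp add: m matrix_matrix_mult_def)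
qed

text \<open>On the two exceptional events the distance is bounded by 1; off them all entries of
  \<open>Q m\<close> are at least \<eta> and its columns differ by at most \<open>r\<close>, so the
  chi-squared bound for product laws applies.\<close>

lemma tv_dist_efcp_law_le_prob:
  assumes "x \<in> words n" "x' \<in> words n" "1 \<le> m" "0 < \<eta>"
  shows "tv_dist (words n) (efcp_law Sig n x m) (efcp_law Sig n x' m) \<le>
    prob (small_entry \<eta> m) + prob (far_columns r m) +
    1 / 2 * sqrt (exp (real n * (real CARD('k) * r\<^sup>2 / \<eta>)) - 1)"
proof -
  let ?c = "1 / 2 * sqrt (exp (real n * (real CARD('k) * r\<^sup>2 / \<eta>)) - 1)"
  let ?t = "\<lambda>\<omega>. tv_dist (words n) (word_prob (Q m \<omega>) n x) (word_prob (Q m \<omega>) n x')"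
  have c: "0 \<le> ?c" using assms(4) by simp
  have le: "?t \<omega> \<le> indicator (small_entry \<eta> m) \<omega> + indicator (far_columns r m) \<omega> + ?c"
    if \<omega>: "\<omega> \<in> space M" for \<omega>
  proof (cases "\<omega> \<in> small_entry \<eta> m \<union> far_columns r m")
    case True
    have "?t \<omega> \<le> 1"
      using Q_column_stochastic[OF \<omega>] by (intro tv_dist_le_1 word_prob_nonneg sum_word_prob)
    moreover have "1 \<le> indicator (small_entry \<eta> m) \<omega> + (indicator (far_columns r m) \<omega> :: real)"
      using True by (auto simp: indicator_def)
    ultimately show ?thesis using c by linarith
  next
    case False
    then have S: "\<And>a b. \<eta> \<le> S m \<omega> $ a $ b"
      and r: "\<And>a b c. \<bar>Q m \<omega> $ c $ a - Q m \<omega> $ c $ b\<bar> \<le> r"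
      using \<omega> unfolding small_entry_def far_columns_def by (auto simp: not_less)
    have "?t \<omega> \<le> ?c"
      unfolding word_prob_def
      using Q_entry_ge[OF assms(3) \<omega> S] column_stochasticD(2)[OF Q_column_stochastic[OF \<omega>]] r assms(4)
      by (intro tv_dist_prod_le) auto
    then show ?thesis using False by (simp add: indicator_def)
  qed
  have "tv_dist (words n) (efcp_law Sig n x m) (efcp_law Sig n x' m) \<le> (\<integral>\<omega>. ?t \<omega> \<partial>M)"
    by (rule tv_dist_efcp_law_le[OF assms(1,2)])
  also have "\<dots> \<le> (\<integral>\<omega>. indicator (small_entry \<eta> m) \<omega> + indicator (far_columns r m) \<omega> + ?c \<partial>M)"
  proof (rule integral_mono)
    show "integrable M ?t"
      unfolding tv_dist_def using integrable_word_prob_Q by auto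
    show "integrable M (\<lambda>\<omega>. indicator (small_entry \<eta> m) \<omega> + indicator (far_columns r m) \<omega> + ?c)"
      using small_entry_events[OF assms(3)] far_columns_events
      by (intro Bochner_Integration.integrable_add) (auto simp: emeasure_eq_measure)
  qed (rule le)
  also have "\<dots> = prob (small_entry \<eta> m) + prob (far_columns r m) + ?c"
    using small_entry_events[OF assms(3)] far_columns_events[of r m]
    by (simp add: emeasure_eq_measure prob_space)
  finally show ?thesis .
qed

lemma prob_small_entry:
  assumes "1 \<le> m"
  shows "prob (small_entry \<eta> m) = measure Sig {A \<in> space Sig. \<exists>a b. A $ a $ b < \<eta>}"
proof -
  have "measure (distr M Sig (S m)) {A \<in> space Sig. \<exists>a b. A $ a $ b < \<eta>} = prob (small_entry \<eta> m)"
    using measurable_space[OF S_measurable[OF assms]] S_measurable[OF assms]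
    by (subst measure_distr) (auto simp: small_entry_def intro!: arg_cong[where f = prob])
  then show ?thesis using S_law[OF assms] by simp
qed

text \<open>Entries are almost surely positive, so the probability of an entry below
  \<open>1 / Suc j\<close> tends to 0 under \<open>Sig\<close>; equality of laws makes the threshold
  valid at all times.\<close>

lemma small_entry_uniform:
  assumes pos: "\<And>a b. AE A in Sig. A $ a $ b \<noteq> 0" and e: "0 < e"
  obtains \<eta> where "0 < \<eta>" "\<And>m. 1 \<le> m \<Longrightarrow> prob (small_entry \<eta> m) < e"
proof -
  interpret Sig: prob_space Sig
    using prob_space_distr[OF S_measurable[of 1]] S_law[of 1] by simp
  let ?E = "\<lambda>j. {A \<in> space Sig. \<exists>a b. A $ a $ b < 1 / real (Suc j)}"
  have "AE A in Sig. \<forall>a b. A $ a $ b \<noteq> 0" using pos by (simp add: AE_all_countable)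
  then have "AE A in Sig. \<forall>\<^sub>F j in sequentially. A \<notin> ?E j"
  proof (rule AE_mp, intro AE_I2 impI)
    fix A assume A: "A \<in> space Sig" "\<forall>a b. A $ a $ b \<noteq> 0"
    then have "\<forall>\<^sub>F j in sequentially. 1 / real (Suc j) < A $ a $ b" for a b
      using column_stochasticD(1)[of A a b] space_Sig
      by (intro order_tendstoD(2)[OF LIMSEQ_Suc[OF lim_1_over_n]]) (auto simp: less_le)
    then have "\<forall>\<^sub>F j in sequentially. \<forall>a b. 1 / real (Suc j) < A $ a $ b"
      by (intro eventually_all_finite)
    then show "\<forall>\<^sub>F j in sequentially. A \<notin> ?E j" by eventually_elim (auto simp: not_less less_imp_le)
  qed
  then have "(\<lambda>j. measure Sig (?E j)) \<longlonglongrightarrow> 0"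
    by (intro Sig.prob_tendsto_0) measurable
  then have "\<forall>\<^sub>F j in sequentially. measure Sig (?E j) < e" using e by (rule order_tendstoD)
  then obtain j where "measure Sig (?E j) < e" using eventually_happens by fastforce
  then show thesis using that[of "1 / real (Suc j)"] prob_small_entry by simp
qed

section \<open>Existence and uniqueness of equilibrium\<close>

lemma efcp_stationary_distribution_law:
  assumes q: "efcp_stationary_distribution Sig n q" and y: "y \<in> words n"
  shows "(\<Sum>x\<in>words n. q x * efcp_law Sig n x m y) = q y"
  using y
proof (induction m arbitrary: y)
  case 0
  then show ?case by (simp add: if_distrib[of "\<lambda>t. _ * t"] cong: if_cong)
next
  case (Suc m)
  have "(\<Sum>x\<in>words n. q x * efcp_law Sig n x (Suc m) y) =
      (\<Sum>u\<in>words n. (\<Sum>x\<in>words n. q x * efcp_law Sig n x m u) * efcp_kernel Sig n u y)"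
    unfolding efcp_law.simps sum_distrib_left sum_distrib_right
    by (subst sum.swap) (simp add: mult_ac)
  also have "\<dots> = q y"
    using Suc q unfolding efcp_stationary_distribution_def by simp
  finally show ?case .
qed

text \<open>Merging of all initial words makes the laws from one word a Cauchy sequence, and the
  limit does not depend on the word. Any stationary distribution is a mixture of laws at every time,
  so it must equal this limit, which justifies \<open>THE\<close>.\<close>

lemma efcp_stationary:
  assumes contr: "\<And>e. 0 < e \<Longrightarrow> \<exists>m0. \<forall>m\<ge>m0. \<forall>x\<in>words n. \<forall>x'\<in>words n.
      tv_dist (words n) (efcp_law Sig n x m) (efcp_law Sig n x' m) < e"
  shows "efcp_stationary_distribution Sig n (efcp_stationary Sig n)"
    and "\<And>x y. x \<in> words n \<Longrightarrow> y \<in> words n \<Longrightarrow>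
      (\<lambda>m. efcp_law Sig n x m y) \<longlonglongrightarrow> efcp_stationary Sig n y"
proof -
  define x0 :: "nat \<Rightarrow> 'k" where "x0 = restrict (\<lambda>_. undefined) {1..n}"
  have x0: "x0 \<in> words n" unfolding x0_def words_def by auto
  have diff: "\<exists>m0. \<forall>m\<ge>m0. \<forall>x\<in>words n. \<forall>x'\<in>words n. \<bar>efcp_law Sig n x m y - efcp_law Sig n x' m y\<bar> < e"
    if "0 < e" "y \<in> words n" for e y
  proof -
    have le: "\<bar>efcp_law Sig n x m y - efcp_law Sig n x' m y\<bar> \<le>
        2 * tv_dist (words n) (efcp_law Sig n x m) (efcp_law Sig n x' m)" for m x x'
      using that(2) by (intro abs_diff_le_tv_dist) auto
    obtain m0 where m0: "\<forall>m\<ge>m0. \<forall>x\<in>words n. \<forall>x'\<in>words n.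
        tv_dist (words n) (efcp_law Sig n x m) (efcp_law Sig n x' m) < e / 2"
      using contr[of "e / 2"] \<open>0 < e\<close> by auto
    show ?thesis
    proof (intro exI allI ballI impI)
      fix m and x x' :: "nat \<Rightarrow> 'k" assume "m0 \<le> m" "x \<in> words n" "x' \<in> words n"
      then have "tv_dist (words n) (efcp_law Sig n x m) (efcp_law Sig n x' m) < e / 2"
        using m0 by blast
      then show "\<bar>efcp_law Sig n x m y - efcp_law Sig n x' m y\<bar> < e"
        using le[of x m x'] by linarith
    qed
  qed
  have "convergent (\<lambda>m. efcp_law Sig n x0 m y)" if y: "y \<in> words n" for y
  proof (rule Cauchy_convergent, rule metric_CauchyI)
    fix e :: real assume "0 < e"
    then obtain m0 where m0: "\<And>m x x'. m \<ge> m0 \<Longrightarrow> x \<in> words n \<Longrightarrow> x' \<in> words n \<Longrightarrow>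
        \<bar>efcp_law Sig n x m y - efcp_law Sig n x' m y\<bar> < e / 3"
      using diff[of "e / 3" y] y by auto
    have "\<bar>efcp_law Sig n x0 m y - efcp_law Sig n x0 m0 y\<bar> \<le> e / 3" if "m0 \<le> m" for m
    proof -
      \<comment> \<open>The \<open>m0\<close> steps come last: the law at time \<open>m\<close> is
        then a mixture of laws at time \<open>m0\<close>, where all initial words agree up to
        \<open>e / 3\<close>.\<close>
      define j where "j = m - m0"
      have m: "m = j + m0" using that by (simp add: j_def)
      have "efcp_law Sig n x0 m y - efcp_law Sig n x0 m0 y =
          (\<Sum>z\<in>words n. efcp_law Sig n x0 j z * (efcp_law Sig n z m0 y - efcp_law Sig n x0 m0 y))"
        unfolding m efcp_law_add[OF y] right_diff_distrib sum_subtractf sum_distrib_right[symmetric]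
          sum_efcp_law[OF x0] by simp
      also have "\<bar>\<dots>\<bar> \<le> (\<Sum>z\<in>words n. efcp_law Sig n x0 j z * \<bar>efcp_law Sig n z m0 y - efcp_law Sig n x0 m0 y\<bar>)"
        using efcp_law_nonneg[OF x0] by (intro order_trans[OF sum_abs] sum_mono) (auto simp: abs_mult)
      also have "\<dots> \<le> (\<Sum>z\<in>words n. efcp_law Sig n x0 j z * (e / 3))"
        using efcp_law_nonneg[OF x0] m0[OF order_refl _ x0]
        by (intro sum_mono mult_left_mono) (auto intro: less_imp_le)
      also have "\<dots> = e / 3"
        unfolding sum_distrib_right[symmetric] sum_efcp_law[OF x0] by simp
      finally show ?thesis .
    qed
    note close = this
    show "\<exists>M. \<forall>m\<ge>M. \<forall>m'\<ge>M. dist (efcp_law Sig n x0 m y) (efcp_law Sig n x0 m' y) < e"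
    proof (intro exI allI impI)
      fix m m' assume "m0 \<le> m" "m0 \<le> m'"
      then show "dist (efcp_law Sig n x0 m y) (efcp_law Sig n x0 m' y) < e"
        using close[of m] close[of m'] \<open>0 < e\<close> unfolding dist_real_def by linarith
    qed
  qed
  then obtain q0 where q0: "\<And>y. y \<in> words n \<Longrightarrow> (\<lambda>m. efcp_law Sig n x0 m y) \<longlonglongrightarrow> q0 y"
    unfolding convergent_def by metis
  \<comment> \<open>\<open>efcp_stationary_distribution\<close> demands the value 0 off
    \<open>words n\<close>; this makes uniqueness hold for functions on the whole type.\<close>
  define q where "q y = (if y \<in> words n then q0 y else 0)" for y
  have lim: "(\<lambda>m. efcp_law Sig n x m y) \<longlonglongrightarrow> q y" if "x \<in> words n" "y \<in> words n" for x y
  proof -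
    have "(\<lambda>m. efcp_law Sig n x m y - efcp_law Sig n x0 m y) \<longlonglongrightarrow> 0"
      using diff[OF _ that(2)] that(1) x0 by (intro LIMSEQ_I) (simp, blast)
    then have "(\<lambda>m. (efcp_law Sig n x m y - efcp_law Sig n x0 m y) + efcp_law Sig n x0 m y) \<longlonglongrightarrow> 0 + q y"
      unfolding q_def using q0 that by (intro tendsto_add) auto
    then show ?thesis by simp
  qed
  have stat: "efcp_stationary_distribution Sig n q"
    unfolding efcp_stationary_distribution_def
  proof (intro conjI allI ballI impI)
    show "0 \<le> q y" for y
    proof (cases "y \<in> words n")
      case True
      show ?thesis
        using LIMSEQ_le_const[OF lim[OF x0 True], of 0] efcp_law_nonneg[OF x0 True] by auto
    qed (simp add: q_def)
    show "x \<notin> words n \<Longrightarrow> q x = 0" for x by (simp add: q_def)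
    have "(\<lambda>m. \<Sum>y\<in>words n. efcp_law Sig n x0 m y) \<longlonglongrightarrow> (\<Sum>y\<in>words n. q y)"
      by (intro tendsto_sum lim x0)
    then show "(\<Sum>x\<in>words n. q x) = 1"
      using sum_efcp_law[OF x0] by (simp add: LIMSEQ_const_iff)
    fix y :: "nat \<Rightarrow> 'k" assume y: "y \<in> words n"
    have "(\<lambda>m. \<Sum>x\<in>words n. efcp_law Sig n x0 m x * efcp_kernel Sig n x y) \<longlonglongrightarrow>
        (\<Sum>x\<in>words n. q x * efcp_kernel Sig n x y)"
      by (intro tendsto_intros lim x0)
    moreover have "(\<lambda>m. efcp_law Sig n x0 (Suc m) y) \<longlonglongrightarrow> q y"
      using lim[OF x0 y] by (rule LIMSEQ_Suc)
    ultimately show "(\<Sum>x\<in>words n. q x * efcp_kernel Sig n x y) = q y"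
      by (simp add: LIMSEQ_unique)
  qed
  have uniq: "q' = q" if q': "efcp_stationary_distribution Sig n q'" for q'
  proof
    fix y
    show "q' y = q y"
    proof (cases "y \<in> words n")
      case True
      have "(\<lambda>m. \<Sum>x\<in>words n. q' x * efcp_law Sig n x m y) \<longlonglongrightarrow> (\<Sum>x\<in>words n. q' x * q y)"
        using True by (intro tendsto_intros lim)
      moreover have "(\<Sum>x\<in>words n. q' x * q y) = q y"
        using q' unfolding efcp_stationary_distribution_def by (simp flip: sum_distrib_right)
      ultimately show ?thesis
        using efcp_stationary_distribution_law[OF q' True] by (simp add: LIMSEQ_const_iff)
    next
      case False
      then show ?thesis using q' by (simp add: q_def efcp_stationary_distribution_def)
    qed
  qed
  have eq: "efcp_stationary Sig n = q"
    unfolding efcp_stationary_def using stat uniq by (rule the_equality)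
  show "efcp_stationary_distribution Sig n (efcp_stationary Sig n)" unfolding eq by (rule stat)
  show "\<And>x y. x \<in> words n \<Longrightarrow> y \<in> words n \<Longrightarrow>
      (\<lambda>m. efcp_law Sig n x m y) \<longlonglongrightarrow> efcp_stationary Sig n y" unfolding eq by (rule lim)
qed

end

section \<open>The lower bound\<close>

text \<open>The letters are repeated cyclically, so every full period contributes one position to
  each block. Each block then has size of order \<open>n\<close>, which keeps the fluctuations of
  its letter frequencies at order \<open>1 / sqrt n\<close>.\<close>

lemma balanced_word:
  obtains x :: "nat \<Rightarrow> 'k::finite" where "x \<in> words n"
    "\<And>a. n div CARD('k) \<le> card {i \<in> {1..n}. x i = a}"
proof -
  let ?k = "CARD('k)"
  obtain h :: "nat \<Rightarrow> 'k" where h: "bij_betw h {0..<?k} UNIV"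
    using ex_bij_betw_nat_finite[of "UNIV :: 'k set"] by auto
  define x where "x = (\<lambda>i\<in>{1..n}. h (i mod ?k))"
  have x: "x \<in> words n" unfolding x_def words_def by auto
  moreover have "n div ?k \<le> card {i \<in> {1..n}. x i = a}" for a
  proof -
    obtain j where j: "j < ?k" "h j = a"
      using h unfolding bij_betw_def by (metis UNIV_I atLeastLessThan_iff imageE)
    \<comment> \<open>Positions start at 1, so the residue 0 is represented by \<open>k\<close>
      instead of 0.\<close>
    define j' where "j' = (if j = 0 then ?k else j)"
    have j': "1 \<le> j'" "j' \<le> ?k" "j' mod ?k = j" using j by (auto simp: j'_def)
    let ?f = "\<lambda>s. s * ?k + j'"
    have "?f ` {0..<n div ?k} \<subseteq> {i \<in> {1..n}. x i = a}"
    proof safe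
      fix s assume "s \<in> {0..<n div ?k}"
      then have "(s + 1) * ?k \<le> n div ?k * ?k" by (intro mult_right_mono) auto
      also have "\<dots> \<le> n" by simp
      finally have "?f s \<le> n" using j' by simp
      moreover have "1 \<le> ?f s" using j' by simp
      ultimately show "?f s \<in> {1..n}" by simp
      then show "x (?f s) = a" using j j' by (simp add: x_def)
    qed
    moreover have "inj_on ?f {0..<n div ?k}" by (intro inj_onI) simp
    ultimately show ?thesis
      using card_inj_on_le[of ?f "{0..<n div ?k}" "{i \<in> {1..n}. x i = a}"] by simp
  qed
  ultimately show thesis by (rule that)
qed

lemma sum_UN_le:
  fixes f :: "'a \<Rightarrow> 'b::ordered_comm_monoid_add"
  assumes "finite I" "\<And>i. i \<in> I \<Longrightarrow> finite (B i)" "\<And>x. 0 \<le> f x"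
  shows "sum f (\<Union>i\<in>I. B i) \<le> (\<Sum>i\<in>I. sum f (B i))"
  using assms(1,2)
proof (induction I rule: finite_induct)
  case (insert i I)
  let ?U = "\<Union>i\<in>I. B i"
  have "sum f (B i \<union> ?U) \<le> sum f (B i \<union> ?U) + sum f (B i \<inter> ?U)"
    using assms(3) by (simp add: add_increasing2 sum_nonneg)
  also have "\<dots> = sum f (B i) + sum f ?U"
    using insert by (intro sum.union_inter) auto
  also have "\<dots> \<le> sum f (B i) + (\<Sum>i\<in>I. sum f (B i))"
    using insert by (intro add_left_mono) auto
  finally show ?case using insert by simp
qed simp

text \<open>Weights of a two-sample comparison: applied to letter indicators they give the frequency
  in block \<open>a\<close> minus that in block \<open>b\<close>. Their total is 0 when no block is
  empty, so a letter probability common to all positions cancels.\<close>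

definition contrast :: "nat \<Rightarrow> (nat \<Rightarrow> 'k) \<Rightarrow> 'k \<Rightarrow> 'k \<Rightarrow> nat \<Rightarrow> real" where
  "contrast n x a b i = of_bool (x i = a) / real (card {i \<in> {1..n}. x i = a})
     - of_bool (x i = b) / real (card {i \<in> {1..n}. x i = b})"

lemma sum_block_average:
  fixes n :: nat
  assumes "0 < card {i \<in> {1..n}. x i = a}"
  shows "(\<Sum>i=1..n. of_bool (x i = a) / real (card {i \<in> {1..n}. x i = a}) * g (x i)) = g a"
proof -
  let ?c = "card {i \<in> {1..n}. x i = a}"
  have "(\<Sum>i=1..n. of_bool (x i = a) / real ?c * g (x i)) = (\<Sum>i=1..n. of_bool (x i = a) * (g a / real ?c))"
    by (intro sum.cong refl) (auto split: if_splits)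
  also have "\<dots> = real ?c * (g a / real ?c)"
  proof -
    have "(\<Sum>i=1..n. of_bool (x i = a)) = real (card ({1..n} \<inter> {i. x i = a}))"
      by simp
    also have "{1..n} \<inter> {i. x i = a} = {i \<in> {1..n}. x i = a}" by auto
    finally show ?thesis unfolding sum_distrib_right[symmetric] by (rule arg_cong)
  qed
  also have "\<dots> = g a"
  proof -
    have "real ?c \<noteq> 0" using assms by (simp only: of_nat_eq_0_iff not_gr_zero[symmetric] not_not)
    then have "u * (v / u) = v" if "u = real ?c" for u v :: real using that by simp
    then show ?thesis by blast
  qed
  finally show ?thesis .
qed

lemma sum_contrast:
  assumes "\<And>a. 0 < card {i \<in> {1..n}. x i = a}"
  shows "(\<Sum>i=1..n. contrast n x a b i * g (x i)) = g a - g b"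
  unfolding contrast_def left_diff_distrib sum_subtractf sum_block_average[OF assms] by (rule refl)

lemma sum_contrast_square:
  assumes "\<And>a. q \<le> real (card {i \<in> {1..n}. x i = a})" "0 < q"
  shows "(\<Sum>i=1..n. (contrast n x a b i)\<^sup>2) \<le> 2 / q"
proof -
  define u where "u a i = of_bool (x i = a) / real (card {i \<in> {1..n}. x i = a})" for a i
  have u0: "0 \<le> u a i" for a i by (simp add: u_def)
  have pos: "0 < card {i \<in> {1..n}. x i = a}" for a
    using assms(1)[of a] assms(2) by (metis less_le_trans of_nat_0_less_iff)
  have u2: "(\<Sum>i=1..n. (u a i)\<^sup>2) \<le> 1 / q" for a
  proof -
    have "(\<Sum>i=1..n. (u a i)\<^sup>2) = (\<Sum>i=1..n. of_bool (x i = a) / real (card {i \<in> {1..n}. x i = a}) * (1 / real (card {i \<in> {1..n}. x i = a})))"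
      by (intro sum.cong) (auto simp: u_def power2_eq_square)
    also have "\<dots> = 1 / real (card {i \<in> {1..n}. x i = a})"
      using sum_block_average[OF pos[of a], where g = "\<lambda>_. 1 / real (card {i \<in> {1..n}. x i = a})"] by simp
    also have "\<dots> \<le> 1 / q" using assms pos[of a] by (intro divide_left_mono mult_pos_pos) auto
    finally show ?thesis .
  qed
  \<comment> \<open>The cross term of the square is nonpositive because both block weights are
    nonnegative.\<close>
  have "(contrast n x a b i)\<^sup>2 \<le> (u a i)\<^sup>2 + (u b i)\<^sup>2" for i
    unfolding contrast_def using u0[of a i] u0[of b i] by (simp add: u_def power2_diff)
  then have "(\<Sum>i=1..n. (contrast n x a b i)\<^sup>2) \<le> (\<Sum>i=1..n. (u a i)\<^sup>2 + (u b i)\<^sup>2)"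
    by (rule sum_mono)
  also have "\<dots> \<le> 1 / q + 1 / q" unfolding sum.distrib by (intro add_mono u2)
  finally show ?thesis by simp
qed

lemma word_prob_variance:
  assumes "A \<in> column_stochastic"
  shows "(\<Sum>y\<in>words n. word_prob A n x y *
      ((\<Sum>i=1..n. w i * of_bool (y i = c)) - (\<Sum>i=1..n. w i * A $ c $ x i))\<^sup>2) \<le> (\<Sum>i=1..n. (w i)\<^sup>2)"
  using variance_product_le[of "\<lambda>i d. A $ d $ x i" n w c] column_stochasticD[OF assms]
  by (simp add: word_prob_def right_diff_distrib sum_subtractf)

context efcp_walk
begin

lemma stationary_contrast_le:
  assumes stat: "efcp_stationary_distribution Sig n (efcp_stationary Sig n)"
    and lim: "\<And>x y. x \<in> words n \<Longrightarrow> y \<in> words n \<Longrightarrow>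
      (\<lambda>m. efcp_law Sig n x m y) \<longlonglongrightarrow> efcp_stationary Sig n y"
    and w: "(\<Sum>i=1..n. w i) = 0"
  shows "(\<Sum>y\<in>words n. efcp_stationary Sig n y * (\<Sum>i=1..n. w i * of_bool (y i = c))\<^sup>2)
    \<le> (\<Sum>i=1..n. (w i)\<^sup>2)"
proof -
  \<comment> \<open>Started from a constant word the letters stay exchangeable, so the contrast is centred at
    every time, hence also in the limit.\<close>
  define x1 :: "nat \<Rightarrow> 'k" where "x1 = (\<lambda>i\<in>{1..n}. c)"
  have x1: "x1 \<in> words n" unfolding x1_def words_def by auto
  have "(\<Sum>y\<in>words n. efcp_law Sig n x1 m y * (\<Sum>i=1..n. w i * of_bool (y i = c))\<^sup>2) \<le> (\<Sum>i=1..n. (w i)\<^sup>2)" for m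
  proof -
    have "(\<Sum>y\<in>words n. word_prob (Q m \<omega>) n x1 y * (\<Sum>i=1..n. w i * of_bool (y i = c))\<^sup>2) \<le> (\<Sum>i=1..n. (w i)\<^sup>2)"
      if "\<omega> \<in> space M" for \<omega>
    proof -
      have "(\<Sum>i=1..n. w i * Q m \<omega> $ c $ x1 i) = (\<Sum>i=1..n. w i * Q m \<omega> $ c $ c)"
        by (intro sum.cong) (auto simp: x1_def)
      also have "\<dots> = 0" using w by (simp flip: sum_distrib_right)
      finally show ?thesis
        using word_prob_variance[OF Q_column_stochastic[OF that, of m], where n = n and x = x1 and w = w and c = c]
        by (simp del: sum_mult_of_bool_eq)
    qed
    then have "(\<integral>\<omega>. (\<Sum>y\<in>words n. word_prob (Q m \<omega>) n x1 y * (\<Sum>i=1..n. w i * of_bool (y i = c))\<^sup>2) \<partial>M)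
        \<le> (\<integral>\<omega>. (\<Sum>i=1..n. (w i)\<^sup>2) \<partial>M)"
      using integrable_word_prob_Q by (intro integral_mono) auto
    then show ?thesis using sum_efcp_law_eq[OF x1 order_refl] by (simp add: prob_space)
  qed
  moreover have "(\<lambda>m. \<Sum>y\<in>words n. efcp_law Sig n x1 m y * (\<Sum>i=1..n. w i * of_bool (y i = c))\<^sup>2) \<longlonglongrightarrow>
      (\<Sum>y\<in>words n. efcp_stationary Sig n y * (\<Sum>i=1..n. w i * of_bool (y i = c))\<^sup>2)"
    by (intro tendsto_intros lim x1)
  ultimately show ?thesis by (intro LIMSEQ_le_const2) auto
qed

text \<open>
  The test statistic compares the letter frequencies of the positions that started with \<open>a\<close> and
  with \<open>b\<close>: these differ by the difference of two columns of \<open>Q m\<close>, up to fluctuations of order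
  \<open>1 / sqrt q\<close>, whereas in equilibrium only the fluctuations remain.
\<close>

lemma tv_dist_stationary_ge:
  assumes stat: "efcp_stationary_distribution Sig n (efcp_stationary Sig n)"
    and lim: "\<And>x y. x \<in> words n \<Longrightarrow> y \<in> words n \<Longrightarrow>
      (\<lambda>m. efcp_law Sig n x m y) \<longlonglongrightarrow> efcp_stationary Sig n y"
    and x: "x \<in> words n" "\<And>a. q \<le> real (card {i \<in> {1..n}. x i = a})" "0 < q" and t: "0 < t"
  shows "1 - prob (near_columns (2 * t) m) - (1 + real CARD('k) ^ 3) * (2 / q / t\<^sup>2) \<le>
    tv_dist (words n) (efcp_law Sig n x m) (efcp_stationary Sig n)"
proof -
  let ?\<pi> = "efcp_stationary Sig n" and ?v = "2 / q / t\<^sup>2"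
  define Z where "Z a b c y = (\<Sum>i=1..n. contrast n x a b i * of_bool (y i = c))" for a b c and y :: "nat \<Rightarrow> 'k"
  \<comment> \<open>The letters \<open>a\<close>, \<open>b\<close>, \<open>c\<close> that witness
    far columns vary with \<omega>, but the test event may not. Taking all triples costs a factor
    \<open>k ^ 3\<close> in equilibrium only; under the chain one witnessing triple
    suffices.\<close>
  define A where "A = (\<Union>(a, b, c)\<in>UNIV. {y \<in> words n. t \<le> \<bar>Z a b c y\<bar>})"
  have A: "A \<subseteq> words n" unfolding A_def by auto
  have v: "0 \<le> ?v" using x(3) by simp
  have pos: "0 < card {i \<in> {1..n}. x i = a}" for a
    using x(2)[of a] x(3) by (metis less_le_trans of_nat_0_less_iff)
  have \<pi>: "\<And>y. 0 \<le> ?\<pi> y" "sum ?\<pi> (words n) = 1"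
    using stat unfolding efcp_stationary_distribution_def by auto
  have "sum ?\<pi> {y \<in> words n. t \<le> \<bar>Z a b c y\<bar>} \<le> ?v" for a b c
  proof -
    have "sum ?\<pi> {y \<in> words n. t \<le> \<bar>Z a b c y\<bar>} \<le> (\<Sum>y\<in>words n. ?\<pi> y * (Z a b c y)\<^sup>2) / t\<^sup>2"
      using \<pi> t by (intro sum_markov) auto
    also have "(\<Sum>y\<in>words n. ?\<pi> y * (Z a b c y)\<^sup>2) \<le> (\<Sum>i=1..n. (contrast n x a b i)\<^sup>2)"
      unfolding Z_def using sum_contrast[OF pos, of a b "\<lambda>_. 1"]
      by (intro stationary_contrast_le[OF stat lim]) auto
    also have "\<dots> \<le> 2 / q" by (rule sum_contrast_square[OF x(2,3)])
    finally show ?thesis using t by (simp add: divide_right_mono)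
  qed
  then have "(\<Sum>(a, b, c)\<in>UNIV. sum ?\<pi> {y \<in> words n. t \<le> \<bar>Z a b c y\<bar>}) \<le> (\<Sum>(a :: 'k, b :: 'k, c :: 'k)\<in>UNIV. ?v)"
    by (intro sum_mono) auto
  moreover have "sum ?\<pi> A \<le> (\<Sum>(a, b, c)\<in>UNIV. sum ?\<pi> {y \<in> words n. t \<le> \<bar>Z a b c y\<bar>})"
    unfolding A_def case_prod_unfold
    by (rule sum_UN_le) (auto simp: \<pi>)
  ultimately have \<pi>A: "sum ?\<pi> A \<le> real CARD('k) ^ 3 * ?v"
    by (simp add: case_prod_unfold card_cartesian_product power3_eq_cube)
  have le: "1 - indicator (near_columns (2 * t) m) \<omega> - ?v \<le> (\<Sum>y\<in>A. word_prob (Q m \<omega>) n x y)"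
    if \<omega>: "\<omega> \<in> space M" for \<omega>
  proof (cases "\<omega> \<in> near_columns (2 * t) m")
    case True
    have "0 \<le> (\<Sum>y\<in>A. word_prob (Q m \<omega>) n x y)"
      using word_prob_nonneg[OF Q_column_stochastic[OF \<omega>]] by (intro sum_nonneg)
    moreover have "indicator (near_columns (2 * t) m) \<omega> = (1 :: real)" using True by simp
    ultimately show ?thesis using v by linarith
  next
    case False
    then obtain a b c where abc: "2 * t \<le> \<bar>Q m \<omega> $ c $ a - Q m \<omega> $ c $ b\<bar>"
      using \<omega> unfolding near_columns_def by (auto simp: not_less)
    let ?d = "Q m \<omega> $ c $ a - Q m \<omega> $ c $ b"
    have d: "(\<Sum>i=1..n. contrast n x a b i * Q m \<omega> $ c $ x i) = ?d"
      by (rule sum_contrast[OF pos])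
    \<comment> \<open>The statistic is centred at \<open>?d\<close>, of size at least
      \<open>2 * t\<close>, and stays below \<open>t\<close> off \<open>A\<close>; it therefore
      deviates by at least \<open>t\<close>, which explains the radius \<open>2 * t\<close>.\<close>
    have "(\<Sum>y\<in>words n - A. word_prob (Q m \<omega>) n x y) \<le>
        (\<Sum>y\<in>words n. word_prob (Q m \<omega>) n x y * (Z a b c y - ?d)\<^sup>2) / t\<^sup>2"
    proof (rule sum_markov)
      fix y assume "y \<in> words n - A"
      then have "\<not> t \<le> \<bar>Z a b c y\<bar>" unfolding A_def by blast
      then show "t \<le> \<bar>Z a b c y - ?d\<bar>" using abc by linarith
    qed (use word_prob_nonneg[OF Q_column_stochastic[OF \<omega>]] t in auto)
    also have "\<dots> \<le> (\<Sum>i=1..n. (contrast n x a b i)\<^sup>2) / t\<^sup>2"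
      using word_prob_variance[OF Q_column_stochastic[OF \<omega>, of m], where n = n and x = x and w = "contrast n x a b" and c = c]
      unfolding Z_def d by (intro divide_right_mono) auto
    also have "\<dots> \<le> ?v"
      using sum_contrast_square[OF x(2,3)] by (intro divide_right_mono) auto
    finally have "(\<Sum>y\<in>words n - A. word_prob (Q m \<omega>) n x y) \<le> ?v" .
    moreover have "(\<Sum>y\<in>words n. word_prob (Q m \<omega>) n x y) =
        (\<Sum>y\<in>words n - A. word_prob (Q m \<omega>) n x y) + (\<Sum>y\<in>A. word_prob (Q m \<omega>) n x y)"
      using A by (intro sum.subset_diff) auto
    ultimately show ?thesis
      using False sum_word_prob[OF Q_column_stochastic[OF \<omega>, of m], of n x] by simp
  qed
  have "1 - prob (near_columns (2 * t) m) - ?v = (\<integral>\<omega>. 1 - indicator (near_columns (2 * t) m) \<omega> - ?v \<partial>M)"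
    using near_columns_events by (simp add: emeasure_eq_measure prob_space)
  also have "\<dots> \<le> (\<integral>\<omega>. (\<Sum>y\<in>A. word_prob (Q m \<omega>) n x y) \<partial>M)"
    using le integrable_word_prob_Q near_columns_events
    by (intro integral_mono) (auto simp: emeasure_eq_measure)
  also have "\<dots> = sum (efcp_law Sig n x m) A"
    using sum_efcp_law_eq[OF x(1) A, of m "\<lambda>_. 1"] by simp
  finally have "1 - prob (near_columns (2 * t) m) - ?v \<le> sum (efcp_law Sig n x m) A" .
  moreover have "sum (efcp_law Sig n x m) A - sum ?\<pi> A \<le> tv_dist (words n) (efcp_law Sig n x m) ?\<pi>"
    using sum_efcp_law[OF x(1)] \<pi> A by (intro tv_dist_ge) auto
  ultimately show ?thesis using \<pi>A unfolding distrib_right mult_1 by linarith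
qed

end

section \<open>Cutoff\<close>

lemma powr_square: "(x powr b)\<^sup>2 = x powr (2 * b)" for x b :: real
  unfolding power2_eq_square powr_add[symmetric] mult_2 ..

lemma eventually_le_ln:
  assumes "0 < c"
  shows "\<forall>\<^sub>F n in sequentially. z \<le> c * ln (real n)"
proof -
  have "filterlim (\<lambda>n. ln (real n)) at_top sequentially"
    by (rule filterlim_compose[OF ln_at_top filterlim_real_sequentially])
  then have "\<forall>\<^sub>F n in sequentially. z / c \<le> ln (real n)" by (simp add: filterlim_at_top)
  then show ?thesis using assms by (auto elim!: eventually_mono simp: divide_le_eq mult.commute)
qed

lemma filterlim_nat_floor_ln:
  assumes "0 < c"
  shows "filterlim (\<lambda>n. nat \<lfloor>c * ln (real n)\<rfloor>) at_top sequentially"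
  unfolding filterlim_at_top
proof
  fix Z :: nat
  show "\<forall>\<^sub>F n in sequentially. Z \<le> nat \<lfloor>c * ln (real n)\<rfloor>"
    using eventually_le_ln[OF assms, of "real Z"] by eventually_elim (rule le_nat_floor)
qed

lemma tendsto_powr_neg:
  assumes "0 < s"
  shows "(\<lambda>n. real n powr (- s)) \<longlonglongrightarrow> 0"
  using assms by (intro tendsto_neg_powr filterlim_real_sequentially) auto

locale efcp_rate = efcp_walk M Sig S
  for M :: "'w measure" and Sig :: "(real ^ 'k ^ 'k) measure" and S :: "nat \<Rightarrow> 'w \<Rightarrow> real ^ 'k ^ 'k" +
  fixes lam1 :: real
  assumes k_ge_2: "CARD('k) \<ge> 2"
    and entry_neq_0: "\<And>a b. AE A in Sig. A $ a $ b \<noteq> 0"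
    and lam1_pos: "0 < lam1" and lam1_less_1: "lam1 < 1"
    and lam1_limit: "AE \<omega> in M.
      (\<lambda>m. root m (largest_singular_value_on zero_sum_space
              (\<lambda>v. left_product (\<lambda>j. S j \<omega>) m *v v))) \<longlonglongrightarrow> lam1"
begin

definition sigma_max :: "nat \<Rightarrow> 'w \<Rightarrow> real" where
  "sigma_max m \<omega> = largest_singular_value_on zero_sum_space (\<lambda>v. Q m \<omega> *v v)"

lemma sigma_max:
  assumes "\<omega> \<in> space M"
  shows "\<bar>Q m \<omega> $ c $ a - Q m \<omega> $ c $ b\<bar> \<le> 2 * sigma_max m \<omega>"
    and "\<exists>a b c. sigma_max m \<omega> \<le> real CARD('k) ^ 2 * \<bar>Q m \<omega> $ c $ a - Q m \<omega> $ c $ b\<bar>"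
  unfolding sigma_max_def
  by (rule column_diff_le_largest_singular_value[OF k_ge_2 Q_column_stochastic[OF assms]])+

lemma sigma_max_nonneg: "\<omega> \<in> space M \<Longrightarrow> 0 \<le> sigma_max m \<omega>"
  using sigma_max(1)[of \<omega> m undefined undefined undefined] by simp

text \<open>A root limit below \<beta> eventually gives
  \<open>sigma_max m \<omega> < \<beta> ^ m\<close>; the factor 2 is the constant in the comparison
  with column differences.\<close>

lemma far_columns_tendsto_0:
  assumes "lam1 < \<beta>"
  shows "(\<lambda>m. prob (far_columns (2 * \<beta> ^ m) m)) \<longlonglongrightarrow> 0"
proof (rule prob_tendsto_0)
  show "AE \<omega> in M. \<forall>\<^sub>F m in sequentially. \<omega> \<notin> far_columns (2 * \<beta> ^ m) m"
    using lam1_limit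
  proof (rule AE_mp, intro AE_I2 impI)
    fix \<omega> assume \<omega>: "\<omega> \<in> space M" and "(\<lambda>m. root m (largest_singular_value_on zero_sum_space
              (\<lambda>v. Q m \<omega> *v v))) \<longlonglongrightarrow> lam1"
    then have "\<forall>\<^sub>F m in sequentially. root m (sigma_max m \<omega>) < \<beta>"
      unfolding sigma_max_def using assms by (intro order_tendstoD)
    \<comment> \<open>Undoing the root by a power requires \<open>m > 0\<close>.\<close>
    with eventually_gt_at_top[of 0] show "\<forall>\<^sub>F m in sequentially. \<omega> \<notin> far_columns (2 * \<beta> ^ m) m"
    proof eventually_elim
      case (elim m)
      have "sigma_max m \<omega> = root m (sigma_max m \<omega>) ^ m"
        using elim sigma_max_nonneg[OF \<omega>] by simp
      also have "\<dots> < \<beta> ^ m"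
        using elim sigma_max_nonneg[OF \<omega>] by (intro power_strict_mono) auto
      finally have "\<bar>Q m \<omega> $ c $ a - Q m \<omega> $ c $ b\<bar> \<le> 2 * \<beta> ^ m" for a b c
        using sigma_max(1)[OF \<omega>, of m c a b] by linarith
      then show ?case unfolding far_columns_def by (auto simp: not_less)
    qed
  qed
qed simp

lemma near_columns_tendsto_0:
  assumes "0 < \<alpha>" "\<alpha> < lam1"
  shows "(\<lambda>m. prob (near_columns (\<alpha> ^ m / real CARD('k) ^ 2) m)) \<longlonglongrightarrow> 0"
proof (rule prob_tendsto_0)
  show "AE \<omega> in M. \<forall>\<^sub>F m in sequentially. \<omega> \<notin> near_columns (\<alpha> ^ m / real CARD('k) ^ 2) m"
    using lam1_limit
  proof (rule AE_mp, intro AE_I2 impI)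
    fix \<omega> assume \<omega>: "\<omega> \<in> space M" and "(\<lambda>m. root m (largest_singular_value_on zero_sum_space
              (\<lambda>v. Q m \<omega> *v v))) \<longlonglongrightarrow> lam1"
    then have "\<forall>\<^sub>F m in sequentially. \<alpha> < root m (sigma_max m \<omega>)"
      unfolding sigma_max_def using assms by (intro order_tendstoD)
    with eventually_gt_at_top[of 0]
    show "\<forall>\<^sub>F m in sequentially. \<omega> \<notin> near_columns (\<alpha> ^ m / real CARD('k) ^ 2) m"
    proof eventually_elim
      case (elim m)
      have "\<alpha> ^ m < root m (sigma_max m \<omega>) ^ m"
        using elim assms by (intro power_strict_mono) auto
      also have "\<dots> = sigma_max m \<omega>"
        using elim sigma_max_nonneg[OF \<omega>] by simp
      finally obtain a b c where "\<alpha> ^ m < real CARD('k) ^ 2 * \<bar>Q m \<omega> $ c $ a - Q m \<omega> $ c $ b\<bar>"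
        using sigma_max(2)[OF \<omega>, of m] by (meson less_le_trans)
      then have "\<alpha> ^ m / real CARD('k) ^ 2 < \<bar>Q m \<omega> $ c $ a - Q m \<omega> $ c $ b\<bar>"
        by (simp add: divide_less_eq mult.commute)
      then show ?case unfolding near_columns_def by (auto simp: not_less intro: less_imp_le)
    qed
  qed
qed simp

text \<open>Here \<open>n\<close> is fixed, so the chi-squared term vanishes as
  \<open>\<beta> ^ m\<close> tends to 0 for any \<beta> between \<open>lam1\<close> and 1.\<close>

lemma efcp_contraction:
  assumes "0 < e"
  shows "\<exists>m0. \<forall>m\<ge>m0. \<forall>x\<in>words n. \<forall>x'\<in>words n.
    tv_dist (words n) (efcp_law Sig n x m) (efcp_law Sig n x' m) < e"
proof -
  obtain \<eta> where \<eta>: "0 < \<eta>" "\<And>m. 1 \<le> m \<Longrightarrow> prob (small_entry \<eta> m) < e / 2"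
    using small_entry_uniform[OF entry_neq_0, of "e / 2"] assms by auto
  obtain \<beta> where \<beta>: "lam1 < \<beta>" "\<beta> < 1" using lam1_less_1 dense by blast
  define b where "b m = prob (far_columns (2 * \<beta> ^ m) m) +
      1 / 2 * sqrt (exp (real n * (real CARD('k) * (2 * \<beta> ^ m)\<^sup>2 / \<eta>)) - 1)" for m
  have "(\<lambda>m. \<beta> ^ m) \<longlonglongrightarrow> 0" using \<beta> lam1_pos by (intro LIMSEQ_power_zero) auto
  then have "b \<longlonglongrightarrow> 0 + 1 / 2 * sqrt (exp (real n * (real CARD('k) * (2 * 0)\<^sup>2 / \<eta>)) - 1)"
    unfolding b_def using \<eta>(1) \<beta> lam1_pos by (intro tendsto_intros far_columns_tendsto_0 \<beta>) auto
  then have "\<forall>\<^sub>F m in sequentially. b m < e / 2" using assms by (intro order_tendstoD(2)) auto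
  with eventually_ge_at_top[of 1] have "\<forall>\<^sub>F m in sequentially. \<forall>x\<in>words n. \<forall>x'\<in>words n.
    tv_dist (words n) (efcp_law Sig n x m) (efcp_law Sig n x' m) < e"
  proof eventually_elim
    case (elim m)
    show ?case
    proof (intro ballI)
      fix x x' :: "nat \<Rightarrow> 'k" assume "x \<in> words n" "x' \<in> words n"
      then have "tv_dist (words n) (efcp_law Sig n x m) (efcp_law Sig n x' m) \<le> prob (small_entry \<eta> m) + b m"
        using tv_dist_efcp_law_le_prob[OF _ _ elim(1) \<eta>(1), of x n x' "2 * \<beta> ^ m"] by (simp add: b_def add.assoc)
      then show "tv_dist (words n) (efcp_law Sig n x m) (efcp_law Sig n x' m) < e"
        using \<eta>(2)[OF elim(1)] elim(2) by linarith
    qed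
  qed
  then show ?thesis by (simp add: eventually_sequentially)
qed

lemmas stationary_distribution = efcp_stationary(1)[OF efcp_contraction]
lemmas law_tendsto_stationary = efcp_stationary(2)[OF efcp_contraction]

section \<open>Worst-case distance from equilibrium as a function of time\<close>

definition worst_tv :: "nat \<Rightarrow> nat \<Rightarrow> real" where
  "worst_tv n m =
    Max ((\<lambda>x0. tv_dist (words n) (efcp_law Sig n x0 m) (efcp_stationary Sig n)) ` words n)"

lemma tv_dist_le_worst_tv:
  "x \<in> words n \<Longrightarrow> tv_dist (words n) (efcp_law Sig n x m) (efcp_stationary Sig n) \<le> worst_tv n m"
  unfolding worst_tv_def by (intro Max_ge) auto

lemma worst_tv_leI:
  assumes "\<And>x. x \<in> words n \<Longrightarrow> tv_dist (words n) (efcp_law Sig n x m) (efcp_stationary Sig n) \<le> b"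
  shows "worst_tv n m \<le> b"
proof -
  have "(\<lambda>i\<in>{1..n}. undefined) \<in> (words n :: (nat \<Rightarrow> 'k) set)" unfolding words_def by auto
  then show ?thesis unfolding worst_tv_def using assms by (intro Max.boundedI) auto
qed

text \<open>By stationarity the equilibrium is a mixture of the laws at time \<open>m\<close>, so
  comparing pairs of initial words suffices.\<close>

lemma worst_tv_le:
  assumes "\<And>x z. x \<in> words n \<Longrightarrow> z \<in> words n \<Longrightarrow>
    tv_dist (words n) (efcp_law Sig n x m) (efcp_law Sig n z m) \<le> b"
  shows "worst_tv n m \<le> b"
proof (rule worst_tv_leI)
  fix x :: "nat \<Rightarrow> 'k" assume x: "x \<in> words n"
  let ?\<pi> = "efcp_stationary Sig n"
  have "tv_dist (words n) (efcp_law Sig n x m) ?\<pi> =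
      tv_dist (words n) (efcp_law Sig n x m) (\<lambda>y. \<Sum>z\<in>words n. ?\<pi> z * efcp_law Sig n z m y)"
    using efcp_stationary_distribution_law[OF stationary_distribution] by (intro tv_dist_cong) auto
  also have "\<dots> \<le> b"
    using stationary_distribution[of n] assms[OF x] unfolding efcp_stationary_distribution_def
    by (intro tv_dist_convex) auto
  finally show "tv_dist (words n) (efcp_law Sig n x m) ?\<pi> \<le> b" .
qed

text \<open>After one step the chain restarts from a random word, so its law at time
  \<open>Suc j\<close> is a mixture of laws at time \<open>j\<close>. Monotonicity lets a large
  distance at one time exclude all earlier mixing times.\<close>

lemma worst_tv_antimono: "m \<le> m' \<Longrightarrow> worst_tv n m' \<le> worst_tv n m"
proof (induction rule: dec_induct)
  case (step j)
  have "worst_tv n (Suc j) \<le> worst_tv n j"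
  proof (rule worst_tv_leI)
    fix x :: "nat \<Rightarrow> 'k" assume x: "x \<in> words n"
    let ?\<pi> = "efcp_stationary Sig n"
    have "tv_dist (words n) (efcp_law Sig n x (Suc j)) ?\<pi> =
        tv_dist (words n) ?\<pi> (\<lambda>y. \<Sum>z\<in>words n. efcp_law Sig n x 1 z * efcp_law Sig n z j y)"
      using efcp_law_add[of _ n x 1 j] by (subst tv_dist_commute) (auto intro!: tv_dist_cong)
    also have "\<dots> \<le> worst_tv n j"
      using efcp_law_nonneg[OF x] sum_efcp_law[OF x] tv_dist_le_worst_tv
      by (intro tv_dist_convex) (auto simp: tv_dist_commute[of _ ?\<pi>] simp del: efcp_law.simps One_nat_def)
    finally show "tv_dist (words n) (efcp_law Sig n x (Suc j)) ?\<pi> \<le> worst_tv n j" .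
  qed
  with step show ?case by simp
qed simp

lemma worst_tv_upper:
  assumes c: "1 / 2 < c * (- ln lam1)" "0 < c" and e: "0 < e"
  shows "\<forall>\<^sub>F n in sequentially. worst_tv n (nat \<lfloor>c * ln (real n)\<rfloor>) < e"
proof -
  define L where "L = - ln lam1"
  define s where "s = (c * L - 1 / 2) / 2"
  have s: "0 < s" "1 / 2 + s < c * L" using c by (auto simp: s_def L_def field_simps)
  \<comment> \<open>Chosen so that \<beta> raised to \<open>c * ln n\<close> is
    \<open>n powr (- (1 / 2 + s))\<close>, where \<open>s\<close> is half the excess in the
    hypothesis on \<open>c\<close>; \<open>a < L\<close> puts \<beta> above
    \<open>lam1\<close>.\<close>
  define a where "a = (1 / 2 + s) / c"
  define \<beta> where "\<beta> = exp (- a)"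
  have a: "0 < a" "a < L" "a * c = 1 / 2 + s"
    using s c by (auto simp: a_def divide_less_eq mult.commute)
  have "lam1 = exp (- L)" using lam1_pos by (simp add: L_def)
  then have \<beta>: "lam1 < \<beta>" using a by (simp add: \<beta>_def)
  let ?m = "\<lambda>n. nat \<lfloor>c * ln (real n)\<rfloor>"
  obtain \<eta> where \<eta>: "0 < \<eta>" "\<And>m. 1 \<le> m \<Longrightarrow> prob (small_entry \<eta> m) < e / 3"
    using small_entry_uniform[OF entry_neq_0, of "e / 3"] e by auto
  \<comment> \<open>The 4 is the squared constant of the radius \<open>2 * \<beta> ^ m\<close>, and
    \<open>exp (2 * a)\<close> pays for rounding the time down by at most 1.\<close>
  define C where "C = real CARD('k) * 4 * exp (2 * a) / \<eta>"
  have pow: "real n * (real CARD('k) * (2 * \<beta> ^ ?m n)\<^sup>2 / \<eta>) \<le> C * real n powr (- (2 * s))"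
    if n: "1 \<le> n" for n
  proof -
    have "c * ln (real n) - 1 \<le> real (?m n)" by linarith
    then have "\<beta> ^ ?m n \<le> exp (- a * (c * ln (real n) - 1))"
      unfolding \<beta>_def using a(1) by (simp flip: exp_of_nat_mult)
    also have "\<dots> = exp a * real n powr (- (1 / 2 + s))"
      using n unfolding a(3)[symmetric] by (simp add: powr_def algebra_simps flip: exp_add)
    finally have "(\<beta> ^ ?m n)\<^sup>2 \<le> (exp a * real n powr (- (1 / 2 + s)))\<^sup>2"
      by (intro power_mono) (auto simp: \<beta>_def)
    also have "\<dots> = exp (2 * a) * real n powr (- 1 - 2 * s)"
    proof -
      have "2 * (- (1 / 2 + s)) = - 1 - 2 * s" by simp
      then show ?thesis
        unfolding power_mult_distrib powr_square by (simp flip: exp_of_nat_mult)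
    qed
    finally have "real n * (real CARD('k) * (4 * (\<beta> ^ ?m n)\<^sup>2) / \<eta>) \<le>
        real n * (real CARD('k) * (4 * (exp (2 * a) * real n powr (- 1 - 2 * s))) / \<eta>)"
      using \<eta> by (intro mult_left_mono divide_right_mono) auto
    also have "\<dots> = C * (real n powr 1 * real n powr (- 1 - 2 * s))"
      using n by (simp add: C_def)
    also have "\<dots> = C * real n powr (- (2 * s))"
      unfolding powr_add[symmetric] by simp
    finally show ?thesis by (simp add: power_mult_distrib)
  qed
  have "(\<lambda>n. 1 / 2 * sqrt (exp (C * real n powr (- (2 * s))) - 1)) \<longlonglongrightarrow> 1 / 2 * sqrt (exp (C * 0) - 1)"
    using s by (intro tendsto_intros tendsto_powr_neg) auto
  then have "\<forall>\<^sub>F n in sequentially. 1 / 2 * sqrt (exp (C * real n powr (- (2 * s))) - 1) < e / 3"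
    by (rule order_tendstoD(2)) (use e in simp)
  moreover have "(\<lambda>n. prob (far_columns (2 * \<beta> ^ ?m n) (?m n))) \<longlonglongrightarrow> 0"
    by (rule filterlim_compose[OF far_columns_tendsto_0[OF \<beta>] filterlim_nat_floor_ln[OF c(2)]])
  then have "\<forall>\<^sub>F n in sequentially. prob (far_columns (2 * \<beta> ^ ?m n) (?m n)) < e / 3"
    using e by (intro order_tendstoD(2)) auto
  moreover have "\<forall>\<^sub>F n in sequentially. 1 \<le> ?m n"
    using filterlim_nat_floor_ln[OF c(2)] by (simp only: filterlim_at_top)
  ultimately show ?thesis using eventually_ge_at_top[of 1]
  proof eventually_elim
    case (elim n)
    let ?t = "1 / 2 * sqrt (exp (real n * (real CARD('k) * (2 * \<beta> ^ ?m n)\<^sup>2 / \<eta>)) - 1)"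
    have "?t \<le> 1 / 2 * sqrt (exp (C * real n powr (- (2 * s))) - 1)"
      using pow[OF elim(4)] by simp
    then have t: "?t < e / 3" using elim(1) by linarith
    have "worst_tv n (?m n) \<le> prob (small_entry \<eta> (?m n)) + prob (far_columns (2 * \<beta> ^ ?m n) (?m n)) + ?t"
      using elim(3) \<eta>(1) by (intro worst_tv_le tv_dist_efcp_law_le_prob)
    also have "\<dots> < e" using t elim(2) \<eta>(2)[OF elim(3)] by linarith
    finally show ?case .
  qed
qed

lemma worst_tv_lower:
  assumes c: "c * (- ln lam1) < 1 / 2" "0 < c" and e: "0 < e"
  shows "\<forall>\<^sub>F n in sequentially. 1 - e < worst_tv n (nat \<lfloor>c * ln (real n)\<rfloor>)"
proof -
  define L where "L = - ln lam1"
  define s where "s = (1 / 2 - c * L) / 2"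
  have cL: "0 < c * L" using c lam1_pos lam1_less_1 by (simp add: L_def mult_pos_neg)
  have s: "0 < s" "c * L < 1 / 2 - s" "0 < 1 / 2 - s" using c cL by (auto simp: s_def L_def field_simps)
  \<comment> \<open>Now \<alpha> raised to \<open>c * ln n\<close> is
    \<open>n powr (s - 1 / 2)\<close>, and \<open>a > L\<close> puts \<alpha> below
    \<open>lam1\<close>. Rounding the time down only enlarges the power of \<alpha>.\<close>
  define a where "a = (1 / 2 - s) / c"
  define \<alpha> where "\<alpha> = exp (- a)"
  have a: "0 < a" "L < a" "a * c = 1 / 2 - s"
    using s c by (auto simp: a_def less_divide_eq mult.commute)
  have "lam1 = exp (- L)" using lam1_pos by (simp add: L_def)
  then have \<alpha>: "0 < \<alpha>" "\<alpha> < lam1" using a by (auto simp: \<alpha>_def)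
  let ?m = "\<lambda>n. nat \<lfloor>c * ln (real n)\<rfloor>" and ?k = "real CARD('k)"
  \<comment> \<open>Half the radius \<open>n powr (s - 1 / 2) / k ^ 2\<close>, since the test needs
    column differences of at least \<open>2 * t n\<close>.\<close>
  define t where "t n = real n powr (s - 1 / 2) / (2 * ?k ^ 2)" for n
  have pow: "2 * t n \<le> \<alpha> ^ ?m n / ?k ^ 2" if n: "1 \<le> n" for n
  proof -
    have "real (?m n) \<le> c * ln (real n)" using c n by simp
    then have "exp (- a * (c * ln (real n))) \<le> \<alpha> ^ ?m n"
      unfolding \<alpha>_def using a(1) by (simp flip: exp_of_nat_mult)
    also have "exp (- a * (c * ln (real n))) = real n powr (- (a * c))"
      using n by (simp add: powr_def)
    also have "- (a * c) = s - 1 / 2" using a by simp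
    finally show ?thesis by (simp add: t_def divide_right_mono)
  qed
  \<comment> \<open>With \<open>q = n / (2 * k)\<close> one has
    \<open>q * (t n)\<^sup>2 = n powr (2 * s) / (8 * k ^ 5)\<close>; the first factor comes from the
    test event.\<close>
  define C where "C = (1 + ?k ^ 3) * (16 * ?k ^ 5)"
  have "(\<lambda>n. C * real n powr (- (2 * s))) \<longlonglongrightarrow> C * 0"
    using s by (intro tendsto_intros tendsto_powr_neg) auto
  then have "\<forall>\<^sub>F n in sequentially. C * real n powr (- (2 * s)) < e / 2"
    using e by (intro order_tendstoD(2)) auto
  moreover have "(\<lambda>n. prob (near_columns (\<alpha> ^ ?m n / ?k ^ 2) (?m n))) \<longlonglongrightarrow> 0"
    by (rule filterlim_compose[OF near_columns_tendsto_0[OF \<alpha>] filterlim_nat_floor_ln[OF c(2)]])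
  then have "\<forall>\<^sub>F n in sequentially. prob (near_columns (\<alpha> ^ ?m n / ?k ^ 2) (?m n)) < e / 2"
    using e by (intro order_tendstoD(2)) auto
  ultimately show ?thesis using eventually_ge_at_top[of "CARD('k)"]
  proof eventually_elim
    case (elim n)
    have n1: "1 \<le> n" using elim(3) k_ge_2 by linarith
    \<comment> \<open>A real lower bound for the block size \<open>n div k\<close>; the factor 2
      absorbs the remainder, as \<open>n \<ge> k\<close>.\<close>
    define q where "q = real n / (2 * ?k)"
    have q0: "0 < q" using n1 by (simp add: q_def)
    obtain x :: "nat \<Rightarrow> 'k" where x: "x \<in> words n" "\<And>a. n div CARD('k) \<le> card {i \<in> {1..n}. x i = a}"
      using balanced_word[of n] by blast
    have "q \<le> real (n div CARD('k))"
    proof -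
      have "n = n div CARD('k) * CARD('k) + n mod CARD('k)" by simp
      also have "\<dots> \<le> n div CARD('k) * CARD('k) + 1 * CARD('k)"
        by (intro add_left_mono) (simp add: less_imp_le)
      also have "\<dots> \<le> n div CARD('k) * CARD('k) + n div CARD('k) * CARD('k)"
        using elim(3) by (intro add_left_mono mult_right_mono) (auto simp: Suc_le_eq div_greater_zero_iff)
      finally have "real n \<le> real (2 * (n div CARD('k) * CARD('k)))" by (subst of_nat_le_iff) simp
      then show ?thesis by (simp add: q_def divide_le_eq mult_ac)
    qed
    then have xq: "q \<le> real (card {i \<in> {1..n}. x i = a})" for a
      using x(2)[of a] by (meson of_nat_mono order_trans)
    have t0: "0 < t n" using n1 by (simp add: t_def)
    have "q * (t n)\<^sup>2 = real n powr 1 * real n powr (2 * s - 1) / (8 * ?k ^ 5)"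
    proof -
      have "(real n powr (s - 1 / 2))\<^sup>2 = real n powr (2 * s - 1)"
        unfolding powr_square by (simp add: right_diff_distrib)
      then show ?thesis using n1 by (simp add: q_def t_def power_divide power_mult_distrib power2_eq_square numeral_eq_Suc)
    qed
    also have "\<dots> = real n powr (2 * s) / (8 * ?k ^ 5)" unfolding powr_add[symmetric] by simp
    finally have "2 / q / (t n)\<^sup>2 = 2 / (real n powr (2 * s) / (8 * ?k ^ 5))" by simp
    also have "\<dots> = 16 * ?k ^ 5 * real n powr (- (2 * s))"
      by (simp add: powr_minus_divide)
    finally have v: "(1 + ?k ^ 3) * (2 / q / (t n)\<^sup>2) = C * real n powr (- (2 * s))"
      by (simp add: C_def)
    have "near_columns (2 * t n) (?m n) \<subseteq> near_columns (\<alpha> ^ ?m n / ?k ^ 2) (?m n)"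
      using pow[OF n1] unfolding near_columns_def by (auto intro: less_le_trans)
    then have "prob (near_columns (2 * t n) (?m n)) \<le> prob (near_columns (\<alpha> ^ ?m n / ?k ^ 2) (?m n))"
      by (intro finite_measure_mono) auto
    moreover have "1 - prob (near_columns (2 * t n) (?m n)) - (1 + ?k ^ 3) * (2 / q / (t n)\<^sup>2) \<le>
        tv_dist (words n) (efcp_law Sig n x (?m n)) (efcp_stationary Sig n)"
      by (rule tv_dist_stationary_ge[OF stationary_distribution law_tendsto_stationary x(1) xq q0 t0])
    ultimately show ?case
      using elim(1,2) tv_dist_le_worst_tv[OF x(1), of "?m n"] unfolding v by linarith
  qed
qed

section \<open>From worst-case distances to mixing times\<close>

lemma efcp_mixing_time_le:
  assumes "1 \<le> m" "worst_tv n m < e"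
  shows "efcp_mixing_time Sig n e \<le> m"
  unfolding efcp_mixing_time_def using assms by (intro Least_le) (simp add: worst_tv_def)

text \<open>Contraction exhibits a time that satisfies the condition, without which
  \<open>LEAST\<close> would say nothing.\<close>

lemma efcp_mixing_time:
  assumes "0 < e"
  shows "1 \<le> efcp_mixing_time Sig n e" "worst_tv n (efcp_mixing_time Sig n e) < e"
proof -
  obtain m0 where m0: "\<And>m x x'. m \<ge> m0 \<Longrightarrow> x \<in> words n \<Longrightarrow> x' \<in> words n \<Longrightarrow>
      tv_dist (words n) (efcp_law Sig n x m) (efcp_law Sig n x' m) < e / 2"
    using efcp_contraction[of "e / 2" n] assms by auto
  have "worst_tv n (Suc m0) \<le> e / 2"
    by (intro worst_tv_le less_imp_le m0) auto
  then have "1 \<le> Suc m0 \<and> worst_tv n (Suc m0) < e" using assms by simp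
  then have "1 \<le> efcp_mixing_time Sig n e \<and> worst_tv n (efcp_mixing_time Sig n e) < e"
    unfolding efcp_mixing_time_def worst_tv_def by (rule LeastI)
  then show "1 \<le> efcp_mixing_time Sig n e" "worst_tv n (efcp_mixing_time Sig n e) < e" by auto
qed

lemma cutoff:
  fixes \<theta> :: real
  assumes \<theta>: "\<theta> = - 1 / (2 * ln lam1)" and \<epsilon>: "0 < \<epsilon>" "\<epsilon> < 1 / 2" and \<delta>: "0 < \<delta>"
  shows "\<forall>\<^sub>F n in sequentially. (\<theta> - \<delta>) * ln (real n) \<le> real (efcp_mixing_time Sig n (1 - \<epsilon>)) \<and>
      efcp_mixing_time Sig n (1 - \<epsilon>) \<le> efcp_mixing_time Sig n \<epsilon> \<and>
      real (efcp_mixing_time Sig n \<epsilon>) \<le> (\<theta> + \<delta>) * ln (real n)"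
proof -
  have L: "0 < - ln lam1" using lam1_pos lam1_less_1 by simp
  have \<theta>L: "\<theta> * (- ln lam1) = 1 / 2" using L \<theta> by (simp add: field_simps)
  have \<theta>0: "0 < \<theta>" using L by (simp add: \<theta> divide_neg_neg)
  have \<delta>L: "0 < \<delta> * (- ln lam1)" using L \<delta> by (intro mult_pos_pos)
  let ?m = "\<lambda>n. nat \<lfloor>(\<theta> + \<delta>) * ln (real n)\<rfloor>" and ?l = "\<lambda>n. nat \<lfloor>(\<theta> - \<delta>) * ln (real n)\<rfloor>"
  have lower: "\<forall>\<^sub>F n in sequentially. (\<theta> - \<delta>) * ln (real n) \<le> real (efcp_mixing_time Sig n (1 - \<epsilon>))"
  \<comment> \<open>For large \<delta> the lower bound is nonpositive once \<open>n \<ge> 1\<close>,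
    and there is no positive time scale at which to test.\<close>
  proof (cases "\<theta> - \<delta> > 0")
    case False
    show ?thesis using eventually_ge_at_top[of 1]
    proof eventually_elim
      case (elim n)
      then have "(\<theta> - \<delta>) * ln (real n) \<le> 0" using False by (intro mult_nonpos_nonneg) auto
      then show ?case by (meson of_nat_0_le_iff order_trans)
    qed
  next
    case True
    have "(\<theta> - \<delta>) * (- ln lam1) < 1 / 2" using \<theta>L \<delta>L by (simp add: left_diff_distrib)
    from worst_tv_lower[OF this True \<epsilon>(1)] show ?thesis
    proof eventually_elim
      case (elim n)
      have "\<not> efcp_mixing_time Sig n (1 - \<epsilon>) \<le> ?l n"
        using worst_tv_antimono[of "efcp_mixing_time Sig n (1 - \<epsilon>)" "?l n" n]
          efcp_mixing_time(2)[of "1 - \<epsilon>" n] elim \<epsilon> by fastforce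
      then show ?case by linarith
    qed
  qed
  have c: "1 / 2 < (\<theta> + \<delta>) * (- ln lam1)" using \<theta>L \<delta>L by (simp add: distrib_right)
  have c0: "0 < \<theta> + \<delta>" using \<theta>0 \<delta> by simp
  have "\<forall>\<^sub>F n in sequentially. 1 \<le> ?m n"
    using filterlim_nat_floor_ln[OF c0] by (simp only: filterlim_at_top)
  with lower worst_tv_upper[OF c c0 \<epsilon>(1)] eventually_ge_at_top[of 1] show ?thesis
  proof eventually_elim
    case (elim n)
    have "real (efcp_mixing_time Sig n \<epsilon>) \<le> real (?m n)"
      using efcp_mixing_time_le[OF elim(4,2)] by simp
    also have "\<dots> \<le> (\<theta> + \<delta>) * ln (real n)" using c0 elim(3) by simp
    finally have "real (efcp_mixing_time Sig n \<epsilon>) \<le> (\<theta> + \<delta>) * ln (real n)" .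
    moreover have "efcp_mixing_time Sig n (1 - \<epsilon>) \<le> efcp_mixing_time Sig n \<epsilon>"
      using efcp_mixing_time[OF \<epsilon>(1), of n] \<epsilon> by (intro efcp_mixing_time_le) auto
    ultimately show ?case using elim(1) by simp
  qed
qed

end

theorem theorem5p7:
  fixes Sig :: "(real ^ 'k ^ 'k) measure"
    and f :: "real ^ 'k ^ 'k \<Rightarrow> real" and p :: real
    and M :: "'w measure" and S :: "nat \<Rightarrow> 'w \<Rightarrow> real ^ 'k ^ 'k"
    and lam1 \<theta> :: real
  assumes k_ge_2: "CARD('k) \<ge> 2"
    and Sig_prob: "prob_space Sig"
    and Sig_borel: "sets Sig = sets (restrict_space borel column_stochastic)"
    and density_measurable: "f \<in> borel_measurable lebesgue_column_stochastic"
    and density_nonneg: "AE A in lebesgue_column_stochastic. 0 \<le> f A"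
    and Sig_density: "Sig = density lebesgue_column_stochastic (\<lambda>A. ennreal (f A))"
    and p_gt_1: "p > 1"
    and density_Lp: "integrable lebesgue_column_stochastic (\<lambda>A. \<bar>f A\<bar> powr p)"
    and M_prob: "prob_space M"
    and S_indep: "prob_space.indep_vars M (\<lambda>_. Sig) S {1..}"
    and S_law: "\<And>m. m \<ge> 1 \<Longrightarrow> distr M Sig (S m) = Sig"
    and lam1_pos: "0 < lam1" and lam1_less_1: "lam1 < 1"
    and lam1_limit: "AE \<omega> in M.
      (\<lambda>m. root m (largest_singular_value_on zero_sum_space
              (\<lambda>v. left_product (\<lambda>j. S j \<omega>) m *v v))) \<longlonglongrightarrow> lam1"
    and theta: "\<theta> = - 1 / (2 * ln lam1)"
  shows "\<forall>\<epsilon>\<in>{0<..<1/2}. \<forall>\<delta>\<in>{0<..<1/2}. \<exists>N. \<forall>n\<ge>N.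
           (\<theta> - \<delta>) * ln (real n) \<le> real (efcp_mixing_time Sig n (1 - \<epsilon>)) \<and>
           efcp_mixing_time Sig n (1 - \<epsilon>) \<le> efcp_mixing_time Sig n \<epsilon> \<and>
           real (efcp_mixing_time Sig n \<epsilon>) \<le> (\<theta> + \<delta>) * ln (real n)"
proof -
  interpret prob_space M by fact
  \<comment> \<open>Absolute continuity carries the null sets of matrices with a zero entry over to
    \<open>Sig\<close>.\<close>
  have "AE A in Sig. A $ a $ b \<noteq> 0" for a b
    unfolding Sig_density using density_measurable AE_lebesgue_column_stochastic_entry_neq_0[OF k_ge_2, of a b]
    by (subst AE_density) auto
  then interpret efcp_rate M Sig S lam1
    using Sig_borel S_indep S_law k_ge_2 lam1_pos lam1_less_1 lam1_limit
    by unfold_locales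
  show ?thesis
    using cutoff[OF theta] by (simp add: eventually_sequentially)
qed

end
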